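(* Let $X$ be a separable, compact, extremally disconnected space. Then Martin's axiom implies that there is a reversible filter $\mathcal{F}$ on $\omega$ that is generated by a tower of height $\mathfrak{c}$ and such that $K_{\mathcal{F}}$ is a $P$-set of $\omega^*$ homeomorphic to $X$.
   Context: Spaces are Hausdorff. $\mathfrak{c}=2^{\aleph_0}$. A space is extremally disconnected if the closure of every open subset is open. $\beta\omega$ is the Stone space of all ultrafilters on $\omega$ and $\omega^*=\beta\omega\setminus\omega$ is the subspace of free ultrafilters. A closed set $K\subset\omega^*$ is a $P$-set of $\omega^*$ if every $G_\delta$ subset of $\omega^*$ containing $K$ is a neighborhood of $K$. A filter on $\omega$ is a nonempty family of subsets of $\omega$ closed under supersets and finite intersections; all filters on $\omega$ are assumed to contain the Fréchet filter of all cofinite subsets of $\omega$. For a filter $\mathcal{F}$ on $\omega$, $\xi(\mathcal{F})$ is the topological space with underlying set $\omega\cup\{\mathcal{F}\}$ in which every point of $\omega$ is isolated and the neighborhoods of the point $\mathcal{F}$ are the sets $\{\mathcal{F}\}\cup A$ with $A\in\mathcal{F}$. A topological space is reversible if every continuous bijection of the space onto itself is a homeomorphism. A filter $\mathcal{F}$ is reversible if the space $\xi(\mathcal{F})$ is reversible. $K_{\mathcal{F}}=\{p\in\beta\omega:\mathcal{F}\subset p\}$, a closed subset of $\omega^*$, considered with the subspace topology. A tower (of height $\kappa$) is a family $\{A_\alpha:\alpha<\kappa\}$ of subsets of $\omega$ such that $A_\beta\setminus A_\alpha$ is finite whenever $\alpha<\beta<\kappa$, and there is no infinite $A\subset\omega$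 such that $A\setminus A_\alpha$ is finite for every $\alpha<\kappa$. The filter generated by a tower is the smallest filter on $\omega$ containing all the sets $A_\alpha$ and all cofinite subsets of $\omega$. *)

theory Defs
  imports "HOL-Analysis.Analysis"
begin

unbundle cardinal_syntax

text \<open>
  The cardinal \<open>2 ^ \<aleph>\<^sub>0\<close>, given as the initial well-order on the type \<open>nat \<Rightarrow> bool\<close>;
  the ordinals below it are represented by the elements of its field.
\<close>

definition continuum :: "(nat \<Rightarrow> bool) rel"
  where "continuum = BNF_Cardinal_Arithmetic.ctwo ^c natLeq"

subsection \<open>Martin's axiom\<close>

text \<open>Here \<open>(p, q) \<in> r\<close> means that \<open>p\<close> extends \<open>q\<close>.\<close>

definition compatible_in :: "'p set \<Rightarrow> 'p rel \<Rightarrow> 'p \<Rightarrow> 'p \<Rightarrow> bool"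
  where "compatible_in P r p q \<longleftrightarrow> (\<exists>s\<in>P. (s, p) \<in> r \<and> (s, q) \<in> r)"

definition ccc_order :: "'p set \<Rightarrow> 'p rel \<Rightarrow> bool"
  where "ccc_order P r \<longleftrightarrow>
    (\<forall>A\<subseteq>P. (\<forall>p\<in>A. \<forall>q\<in>A. p \<noteq> q \<longrightarrow> \<not> compatible_in P r p q) \<longrightarrow> countable A)"

definition dense_in_order :: "'p set \<Rightarrow> 'p rel \<Rightarrow> 'p set \<Rightarrow> bool"
  where "dense_in_order P r D \<longleftrightarrow> D \<subseteq> P \<and> (\<forall>p\<in>P. \<exists>d\<in>D. (d, p) \<in> r)"

definition filter_in_order :: "'p set \<Rightarrow> 'p rel \<Rightarrow> 'p set \<Rightarrow> bool"
  where "filter_in_order P r G \<longleftrightarrow>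
    G \<subseteq> P \<and> G \<noteq> {} \<and>
    (\<forall>p\<in>G. \<forall>q\<in>P. (p, q) \<in> r \<longrightarrow> q \<in> G) \<and>
    (\<forall>p\<in>G. \<forall>q\<in>G. \<exists>s\<in>G. (s, p) \<in> r \<and> (s, q) \<in> r)"

definition martin_property :: "'p set \<Rightarrow> 'p rel \<Rightarrow> bool"
  where "martin_property P r \<longleftrightarrow>
    (\<forall>\<D>. |\<D>| <o continuum \<and> (\<forall>D\<in>\<D>. dense_in_order P r D) \<longrightarrow>
      (\<exists>G. filter_in_order P r G \<and> (\<forall>D\<in>\<D>. G \<inter> D \<noteq> {})))"

text \<open>
  HOL cannot quantify over the posets of all types inside a formula.  The carriers below range
  over all subsets of \<open>nat set\<close>, a type of cardinality continuum, so up to isomorphism all posets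
  of size at most continuum are covered.  This is formally weaker than Martin's axiom for all
  posets, and in fact equivalent to it by the usual Loewenheim-Skolem argument (fewer than
  continuum many dense sets can be met inside a suitable subposet of size less than continuum).
\<close>

definition Martins_axiom :: bool
  where "Martins_axiom \<longleftrightarrow>
    (\<forall>(P :: nat set set) r.
      P \<noteq> {} \<and> partial_order_on P r \<and> ccc_order P r \<longrightarrow> martin_property P r)"

subsection \<open>Topological notions\<close>

definition extremally_disconnected_space :: "'a topology \<Rightarrow> bool"
  where "extremally_disconnected_space X \<longleftrightarrow> (\<forall>U. openin X U \<longrightarrow> openin X (X closure_of U))"

definition reversible_space :: "'a topology \<Rightarrow> bool"
  where "reversible_space X \<longleftrightarrow>
    (\<forall>f. continuous_map X X f \<and> bij_betw f (topspace X) (topspace X) \<longrightarrow> homeomorphic_map X X f)"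

definition P_set :: "'a topology \<Rightarrow> 'a set \<Rightarrow> bool"
  where "P_set X K \<longleftrightarrow>
    closedin X K \<and> (\<forall>G. gdelta_in X G \<and> K \<subseteq> G \<longrightarrow> K \<subseteq> X interior_of G)"

subsection \<open>Filters on the natural numbers\<close>

text \<open>
  A set \<open>A\<close> belongs to the filter \<open>F\<close> iff \<open>\<forall>\<^sub>F n in F. n \<in> A\<close>.  Note that the library order on
  filters is reverse inclusion of the families of members: \<open>p \<le> F\<close> says that every member of \<open>F\<close>
  is a member of \<open>p\<close>, and \<open>F \<le> cofinite\<close> that \<open>F\<close> contains the Frechet filter.
\<close>

definition ultrafilter :: "'a filter \<Rightarrow> bool"
  where "ultrafilter p \<longleftrightarrow>
    p \<noteq> bot \<and> (\<forall>A. (\<forall>\<^sub>F n in p. n \<in> A) \<or> (\<forall>\<^sub>F n in p. n \<notin> A))"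

definition beta_omega :: "nat filter topology"
  where "beta_omega =
    topology_generated_by (range (\<lambda>A. {p. ultrafilter p \<and> (\<forall>\<^sub>F n in p. n \<in> A)}))"

text \<open>The point \<open>n\<close> of \<open>\<omega>\<close> is identified with the principal ultrafilter at \<open>n\<close>.\<close>

definition omega_star :: "nat filter topology"
  where "omega_star = subtopology beta_omega (- range (\<lambda>n. principal {n}))"

definition K_set :: "nat filter \<Rightarrow> nat filter set"
  where "K_set F = {p. ultrafilter p \<and> p \<le> F}"

text \<open>
  The space \<open>\<xi>(F)\<close>: \<open>Some n\<close> stands for \<open>n\<close> and \<open>None\<close> for the point \<open>F\<close>.
\<close>

definition xi :: "nat filter \<Rightarrow> nat option topology"
  where "xi F = topology (\<lambda>U. None \<in> U \<longrightarrow> (\<forall>\<^sub>F n in F. Some n \<in> U))"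

lemma openin_xi: "openin (xi F) U \<longleftrightarrow> (None \<in> U \<longrightarrow> (\<forall>\<^sub>F n in F. Some n \<in> U))"
proof -
  have "istopology (\<lambda>U. None \<in> U \<longrightarrow> (\<forall>\<^sub>F n in F. Some n \<in> U))"
    unfolding istopology_def
  proof (intro conjI allI impI)
    fix S T
    assume "None \<in> S \<longrightarrow> (\<forall>\<^sub>F n in F. Some n \<in> S)" "None \<in> T \<longrightarrow> (\<forall>\<^sub>F n in F. Some n \<in> T)"
      and "None \<in> S \<inter> T"
    then show "\<forall>\<^sub>F n in F. Some n \<in> S \<inter> T"
      by (simp add: eventually_conj)
  next
    fix \<K>
    assume K: "\<forall>S\<in>\<K>. None \<in> S \<longrightarrow> (\<forall>\<^sub>F n in F. Some n \<in> S)" and "None \<in> \<Union>\<K>"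
    then obtain S where "S \<in> \<K>" "None \<in> S"
      by blast
    with K have "\<forall>\<^sub>F n in F. Some n \<in> S"
      by blast
    then show "\<forall>\<^sub>F n in F. Some n \<in> \<Union>\<K>"
      using \<open>S \<in> \<K>\<close> by (rule_tac eventually_mono) blast+
  qed
  then show ?thesis
    by (simp add: xi_def topology_inverse')
qed

definition reversible_filter :: "nat filter \<Rightarrow> bool"
  where "reversible_filter F \<longleftrightarrow> reversible_space (xi F)"

subsection \<open>Towers\<close>

text \<open>The height is given as a well-order \<open>r\<close>; the indices are the elements of its field.\<close>

definition tower :: "'i rel \<Rightarrow> ('i \<Rightarrow> nat set) \<Rightarrow> bool"
  where "tower r A \<longleftrightarrow>
    (\<forall>\<alpha> \<beta>. (\<alpha>, \<beta>) \<in> r \<and> \<alpha> \<noteq> \<beta> \<longrightarrow> finite (A \<beta> - A \<alpha>)) \<and>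
    \<not> (\<exists>B. infinite B \<and> (\<forall>\<alpha>\<in>Field r. finite (B - A \<alpha>)))"

text \<open>
  As the library order is reversed, the greatest lower bound below is the smallest filter (with
  respect to inclusion) containing all \<open>A \<alpha>\<close> and all cofinite sets.
\<close>

definition tower_filter :: "'i rel \<Rightarrow> ('i \<Rightarrow> nat set) \<Rightarrow> nat filter"
  where "tower_filter r A = inf cofinite (INF \<alpha>\<in>Field r. principal (A \<alpha>))"

end

theory Submission
  imports Defs
begin

text \<open>
  Let \<open>B\<close> be the algebra of clopen subsets of \<open>X\<close>.  By Stone duality it suffices to find a tower
  \<open>C\<close> of height continuum and a homomorphism \<open>h\<close> from the power set of \<open>\<omega>\<close> onto \<open>B\<close> whose kernel
  consists of the sets that are almost disjoint from some \<open>C \<alpha>\<close>: if \<open>F\<close> is the filter of the tower,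
  then \<open>x \<mapsto> {M. x \<in> h M}\<close> is a homeomorphism of \<open>X\<close> onto \<open>K_set F\<close>.

  The tower and the graph of \<open>h\<close> are built together in a recursion of length continuum.  Stage \<open>\<alpha>\<close>
  carries an algebra \<open>R \<alpha>\<close> of fewer than continuum many pairs \<open>(M, b)\<close>, which is the part of the
  graph decided so far, and a set \<open>C \<alpha>\<close> which is faithful to it: for \<open>(M, b) \<in> R \<alpha>\<close> the
  intersection \<open>M \<inter> C \<alpha>\<close> is infinite iff \<open>b\<close> is nonempty.  Shrinking \<open>C \<alpha>\<close> can only destroy the
  infinite intersections, and fewer than continuum many of these are protected by Martin's axiom
  (\<open>MA_splitting_pseudointersection\<close>).  Four tasks are met along the recursion.

    \<^item> A limit stage needs a faithful pseudointersection of the earlier \<open>C \<beta>\<close>.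
    \<^item> A given clopen set \<open>b\<close> receives a preimage: any set that splits all intersections which have
      to stay infinite can be paired with \<open>b\<close> (\<open>faithful_adjoin_clopen\<close>).
    \<^item> A given set \<open>M\<close> receives a value.  The value must be disjoint from every \<open>c\<close> with
      \<open>(E, c) \<in> R \<alpha>\<close> and \<open>E \<inter> M \<inter> C \<alpha>\<close> finite; the largest clopen set with this property exists
      because \<open>X\<close> is extremally disconnected, and it works (\<open>faithful_adjoin_set\<close>).
    \<^item> Given an injection \<open>g\<close> of a set \<open>M\<close> into its complement, \<open>C \<alpha>\<close> is thinned out until \<open>g\<close> maps
      no point of \<open>M \<inter> C \<alpha>\<close> into \<open>C \<alpha>\<close> (\<open>faithful_displace\<close>).

  Separability bounds the number of clopen sets by the continuum, so all tasks can be listed.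

  The last task has three consequences.  If \<open>C\<close> had an infinite pseudointersection, an injection of
  one half of it into the other half would contradict the displacement; so \<open>C\<close> is a tower.  Hence no
  countable part of \<open>C\<close> is cofinal, since under Martin's axiom it would have an infinite
  pseudointersection; this makes \<open>K_set F\<close> a \<open>P\<close>-set.  Finally a continuous bijection of \<open>\<xi>(F)\<close>
  is given by a permutation \<open>g\<close> with \<open>g\<^sup>-\<^sup>1(A) \<in> F\<close> for all \<open>A \<in> F\<close>.  Three colours split the
  points moved by \<open>g\<close> into sets \<open>M\<close> disjoint from \<open>g(M)\<close>, and the displacement shows that the
  complement of each of them is in \<open>F\<close>.  So \<open>g\<close> is the identity on a set in \<open>F\<close>, and the bijection
  is open.
\<close>

section \<open>The cardinal of the continuum\<close>

lemma continuum_eq: "continuum = |UNIV :: (nat \<Rightarrow> bool) set|"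
  by (auto simp: continuum_def cexp_def ctwo_def Func_def Field_natLeq Field_card_of)

lemma Card_order_continuum: "Card_order continuum"
  unfolding continuum_eq by (rule card_of_Card_order)

lemma Field_continuum: "Field continuum = UNIV"
  by (simp add: continuum_eq Field_card_of)

abbreviation small :: "'a set \<Rightarrow> bool"
  where "small A \<equiv> |A| <o continuum"

lemma small_nat: "small (UNIV :: nat set)"
proof -
  have "|UNIV :: nat set| <o |UNIV :: nat set set|"
    using card_of_Pow[of "UNIV :: nat set"] by simp
  also have "|UNIV :: nat set set| \<le>o |UNIV :: (nat \<Rightarrow> bool) set|"
    by (rule card_of_ordLeqI[where f = "\<lambda>A n. n \<in> A"]) (auto simp: inj_on_def fun_eq_iff)
  finally show ?thesis by (simp add: continuum_eq)
qed

lemma infinite_continuum: "infinite (UNIV :: (nat \<Rightarrow> bool) set)"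
  using small_nat unfolding continuum_eq
  by (meson card_of_ordLeq_infinite infinite_UNIV_nat ordLess_imp_ordLeq)

lemma small_countable: "countable A \<Longrightarrow> small A"
  using small_nat card_of_ordLeq[of A "UNIV :: nat set"] ordLeq_ordLess_trans
  by (fastforce simp: countable_def)

lemma small_image: "small A \<Longrightarrow> small (f ` A)"
  using card_of_image ordLeq_ordLess_trans by blast

lemma small_subset: "small B \<Longrightarrow> A \<subseteq> B \<Longrightarrow> small A"
  using card_of_mono1 ordLeq_ordLess_trans by blast

lemma small_Un: "small A \<Longrightarrow> small B \<Longrightarrow> small (A \<union> B)"
  using card_of_Un_ordLess_infinite_Field[OF _ Card_order_continuum]
  by (simp add: Field_continuum infinite_continuum)

lemma small_Times:
  assumes "small A" "small B"
  shows "small (A \<times> B)"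
proof -
  let ?C = "(A <+> B) <+> (UNIV :: nat set)"
  have "|A| \<le>o |?C|" "|B| \<le>o |?C|"
    by (meson card_of_Plus1 card_of_Plus2 ordLeq_transitive)+
  then have "|A \<times> B| \<le>o |?C|"
    using card_of_Card_order by (intro card_of_Times_ordLeq_infinite_Field) (auto simp: Field_card_of)
  moreover have "small ?C"
    using assms small_nat infinite_continuum
    by (intro card_of_Plus_ordLess_infinite_Field Card_order_continuum) (simp_all add: Field_continuum)
  ultimately show ?thesis
    by (rule ordLeq_ordLess_trans)
qed

lemma small_image_pairs:
  assumes "small R"
  shows "small {f E c | E c. (E, c) \<in> R \<and> Q E c}"
  by (rule small_subset[OF small_image[OF assms, of "\<lambda>(E, c). f E c"]]) force

lemma Well_order_continuum: "Well_order continuum"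
  using Card_order_continuum by (rule card_order_on_well_order_on)

lemma continuum_linear: "(\<alpha>, \<beta>) \<in> continuum \<or> (\<beta>, \<alpha>) \<in> continuum"
  using wo_rel.TOTALS[of continuum] Well_order_continuum by (simp add: wo_rel_def Field_continuum)

lemma continuum_refl: "(\<alpha>, \<alpha>) \<in> continuum"
  using continuum_linear by blast

lemma continuum_trans: "(\<alpha>, \<beta>) \<in> continuum \<Longrightarrow> (\<beta>, \<gamma>) \<in> continuum \<Longrightarrow> (\<alpha>, \<gamma>) \<in> continuum"
  using wo_rel.TRANS[of continuum] Well_order_continuum by (auto simp: wo_rel_def dest: transD)

lemma wf_continuum: "wf (continuum - Id)"
  using Well_order_continuum by (simp add: well_order_on_def)

lemma continuum_finite_max:
  assumes "finite B" "B \<noteq> {}"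
  shows "\<exists>\<gamma>\<in>B. \<forall>\<beta>\<in>B. (\<beta>, \<gamma>) \<in> continuum"
  using assms
proof (induction rule: finite_ne_induct)
  case (singleton \<beta>)
  then show ?case by (simp add: continuum_refl)
next
  case (insert \<alpha> B)
  then obtain \<gamma> where \<gamma>: "\<gamma> \<in> B" "\<forall>\<beta>\<in>B. (\<beta>, \<gamma>) \<in> continuum" by blast
  show ?case
  proof (cases "(\<alpha>, \<gamma>) \<in> continuum")
    case True
    then show ?thesis using \<gamma> by blast
  next
    case False
    then have "(\<gamma>, \<alpha>) \<in> continuum" using continuum_linear by blast
    then show ?thesis using \<gamma>(2) continuum_trans continuum_refl by (metis insert_iff)
  qed
qed

lemma small_underS: "small (underS continuum \<alpha>)"
  using card_of_underS[OF Card_order_continuum] by (simp add: Field_continuum)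

section \<open>Pseudointersections and splitting sets from Martin's axiom\<close>

text \<open>
  The axiom is only about orders on sets of sets of naturals; an injective coding of the conditions
  transports it to other types.
\<close>

lemma martin_property_of_encoding:
  fixes e :: "'p \<Rightarrow> nat set" and P :: "'p set"
  assumes MA: "Martins_axiom" and e: "inj e"
    and P: "P \<noteq> {}" "partial_order_on P r" "ccc_order P r"
  shows "martin_property P r"
proof -
  define r' where "r' = {(e p, e q) | p q. (p, q) \<in> r}"
  have r'_iff [simp]: "(e p, e q) \<in> r' \<longleftrightarrow> (p, q) \<in> r" for p q
    using e by (auto simp: r'_def dest: injD)
  have r'E: "\<exists>p q. x = e p \<and> y = e q \<and> (p, q) \<in> r" if "(x, y) \<in> r'" for x y
    using that by (auto simp: r'_def)
  have rP: "p \<in> P \<and> q \<in> P" if "(p, q) \<in> r" for p q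
    using P(2) that by (auto simp: partial_order_on_def preorder_on_def)
  have "partial_order_on (e ` P) r'"
    unfolding partial_order_on_def preorder_on_def
  proof (intro conjI)
    show "r' \<subseteq> e ` P \<times> e ` P"
      using rP by (auto simp: r'_def)
    show "refl_on (e ` P) r'"
      using P(2) by (auto simp: partial_order_on_def preorder_on_def refl_on_def)
    show "trans r'"
    proof (rule transI)
      fix x y z assume "(x, y) \<in> r'" "(y, z) \<in> r'"
      then obtain p q q' s where pq: "x = e p" "y = e q" "(p, q) \<in> r"
        and qs: "y = e q'" "z = e s" "(q', s) \<in> r"
        by (meson r'E)
      have "(p, s) \<in> r"
        using P(2) pq qs injD[OF e, of q q']
        by (auto simp: partial_order_on_def preorder_on_def dest: transD)
      then show "(x, z) \<in> r'" by (simp add: pq qs)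
    qed
    show "antisym r'"
    proof (rule antisymI)
      fix x y assume xy: "(x, y) \<in> r'" "(y, x) \<in> r'"
      then obtain p q where pq: "x = e p" "y = e q"
        by (meson r'E)
      with xy have "p = q"
        using P(2) by (auto simp: partial_order_on_def dest: antisymD)
      then show "x = y" by (simp add: pq)
    qed
  qed
  moreover have "ccc_order (e ` P) r'"
    unfolding ccc_order_def
  proof (intro allI impI)
    fix A assume A: "A \<subseteq> e ` P" 
      and anti: "\<forall>p\<in>A. \<forall>q\<in>A. p \<noteq> q \<longrightarrow> \<not> compatible_in (e ` P) r' p q"
    define B where "B = {p \<in> P. e p \<in> A}"
    have "\<forall>p\<in>B. \<forall>q\<in>B. p \<noteq> q \<longrightarrow> \<not> compatible_in P r p q"
    proof (intro ballI impI)
      fix p q assume *: "p \<in> B" "q \<in> B" "p \<noteq> q"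
      then have "\<not> compatible_in (e ` P) r' (e p) (e q)"
        using anti injD[OF e, of p q] by (auto simp: B_def)
      then show "\<not> compatible_in P r p q"
        by (auto simp: compatible_in_def)
    qed
    then have "countable B"
      using P(3) by (auto simp: ccc_order_def B_def)
    moreover have "A = e ` B"
      using A by (auto simp: B_def)
    ultimately show "countable A" by simp
  qed
  ultimately have MP: "martin_property (e ` P) r'"
    using MA P(1) by (simp add: Martins_axiom_def)
  show ?thesis
    unfolding martin_property_def
  proof (intro allI impI, elim conjE)
    fix \<D> assume small: "|\<D>| <o continuum" and dense: "\<forall>D\<in>\<D>. dense_in_order P r D"
    have "small ((`) e ` \<D>)"
      using small by (rule small_image)
    moreover have "\<forall>D\<in>(`) e ` \<D>. dense_in_order (e ` P) r' D"
      using dense by (force simp: dense_in_order_def)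
    ultimately obtain G' where G': "filter_in_order (e ` P) r' G'" "\<forall>D\<in>(`) e ` \<D>. G' \<inter> D \<noteq> {}"
      using MP unfolding martin_property_def by metis
    define G where "G = {p \<in> P. e p \<in> G'}"
    have G'_eq: "G' = e ` G"
      using G'(1) by (auto simp: G_def filter_in_order_def)
    have "filter_in_order P r G"
      unfolding filter_in_order_def
    proof (intro conjI ballI impI)
      have *: "\<forall>x\<in>e ` G. \<forall>y\<in>e ` P. (x, y) \<in> r' \<longrightarrow> y \<in> e ` G"
        "\<forall>x\<in>e ` G. \<forall>y\<in>e ` G. \<exists>z\<in>e ` G. (z, x) \<in> r' \<and> (z, y) \<in> r'" "e ` G \<noteq> {}"
        using G'(1) unfolding filter_in_order_def G'_eq by blast+
      show "G \<subseteq> P" "G \<noteq> {}"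
        using *(3) by (auto simp: G_def)
      show "q \<in> G" if "p \<in> G" "q \<in> P" "(p, q) \<in> r" for p q
        using *(1) that by (simp add: inj_image_mem_iff[OF e])
      show "\<exists>s\<in>G. (s, p) \<in> r \<and> (s, q) \<in> r" if "p \<in> G" "q \<in> G" for p q
        using *(2) that by simp
    qed
    moreover have "\<forall>D\<in>\<D>. G \<inter> D \<noteq> {}"
    proof
      fix D assume "D \<in> \<D>"
      with G'(2) obtain x where "x \<in> e ` G" "x \<in> e ` D"
        unfolding G'_eq by blast
      then show "G \<inter> D \<noteq> {}"
        using injD[OF e] by blast
    qed
    ultimately show "\<exists>G. filter_in_order P r G \<and> (\<forall>D\<in>\<D>. G \<inter> D \<noteq> {})"
      by blast
  qed
qed

lemma inj_encoding_of_triples: "\<exists>e :: nat set \<times> nat set \<times> nat set \<Rightarrow> nat set. inj e"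
proof
  let ?e = "\<lambda>(a, b, c). (\<lambda>n. prod_encode (0, n)) ` a \<union> (\<lambda>n. prod_encode (1, n)) ` b
    \<union> (\<lambda>n. prod_encode (2, n)) ` (c :: nat set)"
  let ?d = "\<lambda>x. ({n. prod_encode (0, n) \<in> x}, {n. prod_encode (1, n) \<in> x}, {n. prod_encode (2, n) \<in> x})"
  have "?d (?e x) = x" for x
    by (cases x) auto
  then show "inj ?e"
    by (rule inj_on_inverseI)
qed

text \<open>
  A condition \<open>(s, t, V)\<close> is a finite part \<open>s\<close> of the generic pseudointersection \<open>C\<close>, the trace \<open>t\<close>
  of the generic splitting set \<open>E\<close> on \<open>s\<close>, and the promise that all further points of \<open>C\<close> are taken
  from \<open>V\<close>.  This is Mathias-Prikry forcing with a Cohen real on the generic set.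
\<close>

definition splitting_conditions :: "nat set set \<Rightarrow> (nat set \<times> nat set \<times> nat set) set"
  where "splitting_conditions \<V> = {(s, t, V). finite s \<and> t \<subseteq> s \<and> V \<in> \<V>}"

definition splitting_order :: "nat set set \<Rightarrow> (nat set \<times> nat set \<times> nat set) rel"
  where "splitting_order \<V> =
    {((s', t', V'), (s, t, V)).
      (s', t', V') \<in> splitting_conditions \<V> \<and> (s, t, V) \<in> splitting_conditions \<V> \<and>
      s \<subseteq> s' \<and> s' - s \<subseteq> V \<and> t' \<inter> s = t \<and> V' \<subseteq> V}"

lemma partial_order_splitting: "partial_order_on (splitting_conditions \<V>) (splitting_order \<V>)"
  unfolding partial_order_on_def preorder_on_def
proof (intro conjI)
  show "splitting_order \<V> \<subseteq> splitting_conditions \<V> \<times> splitting_conditions \<V>"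
    by (auto simp: splitting_order_def)
  show "refl_on (splitting_conditions \<V>) (splitting_order \<V>)"
    by (auto simp: splitting_order_def splitting_conditions_def refl_on_def)
  show "trans (splitting_order \<V>)"
  proof (rule transI)
    fix x y z assume xyz: "(x, y) \<in> splitting_order \<V>" "(y, z) \<in> splitting_order \<V>"
    obtain s t V s' t' V' s'' t'' V''
      where eq: "x = (s'', t'', V'')" "y = (s', t', V')" "z = (s, t, V)"
      by (metis prod_cases3)
    have "t'' \<inter> s = (t'' \<inter> s') \<inter> s"
      using xyz by (auto simp: eq splitting_order_def)
    also have "\<dots> = t"
      using xyz by (simp add: eq splitting_order_def)
    finally show "(x, z) \<in> splitting_order \<V>"
      using xyz by (auto simp: eq splitting_order_def)
  qed
  show "antisym (splitting_order \<V>)"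
  proof (rule antisymI)
    fix x y assume "(x, y) \<in> splitting_order \<V>" "(y, x) \<in> splitting_order \<V>"
    then show "x = y"
      by (cases x; cases y) (auto simp: splitting_order_def splitting_conditions_def)
  qed
qed

text \<open>
  Conditions with the same finite part \<open>(s, t)\<close> are compatible, as the promises can be intersected,
  and there are only countably many finite parts.
\<close>

lemma ccc_splitting:
  assumes Int: "\<And>V W. V \<in> \<V> \<Longrightarrow> W \<in> \<V> \<Longrightarrow> V \<inter> W \<in> \<V>"
  shows "ccc_order (splitting_conditions \<V>) (splitting_order \<V>)"
  unfolding ccc_order_def
proof (intro allI impI)
  fix A assume A: "A \<subseteq> splitting_conditions \<V>"
    and anti: "\<forall>p\<in>A. \<forall>q\<in>A. p \<noteq> q \<longrightarrow> \<not> compatible_in (splitting_conditions \<V>) (splitting_order \<V>) p q"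
  define stem :: "nat set \<times> nat set \<times> nat set \<Rightarrow> nat set \<times> nat set"
    where "stem = (\<lambda>(s, t, V). (s, t))"
  have "inj_on stem A"
  proof (rule inj_onI, rule ccontr)
    fix p q assume pq: "p \<in> A" "q \<in> A" "stem p = stem q" "p \<noteq> q"
    obtain s t V W where st: "p = (s, t, V)" "q = (s, t, W)"
      using pq(3) by (cases p; cases q) (auto simp: stem_def)
    have "(s, t, V \<inter> W) \<in> splitting_conditions \<V>"
      using pq A Int by (auto simp: st splitting_conditions_def)
    moreover have "((s, t, V \<inter> W), p) \<in> splitting_order \<V>" "((s, t, V \<inter> W), q) \<in> splitting_order \<V>"
      using calculation pq A by (auto simp: st splitting_order_def splitting_conditions_def)
    ultimately have "compatible_in (splitting_conditions \<V>) (splitting_order \<V>) p q"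
      unfolding compatible_in_def by blast
    then show False
      using anti pq by blast
  qed
  moreover have "stem ` A \<subseteq> Collect finite \<times> Collect finite"
    using A by (auto simp: stem_def splitting_conditions_def dest: finite_subset)
  moreover have "countable (Collect finite :: nat set set)"
    using countable_Collect_finite .
  ultimately show "countable A"
    by (meson countable_SIGMA countable_image_inj_on countable_subset)
qed

text \<open>
  A version of Solovay's lemma.  Besides being a pseudointersection of \<open>\<W>\<close>, the generic set has
  an infinite intersection with every \<open>P \<in> \<P>\<close>, and \<open>E\<close> splits all these intersections.
\<close>

lemma MA_splitting_pseudointersection:
  assumes MA: "Martins_axiom" and small_\<W>: "small \<W>" and small_\<P>: "small \<P>"
    and inf: "\<And>\<U> P. finite \<U> \<Longrightarrow> \<U> \<subseteq> \<W> \<Longrightarrow> P \<in> \<P> \<Longrightarrow> infinite (P \<inter> \<Inter>\<U>)"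
  obtains C E :: "nat set" where
    "\<And>W. W \<in> \<W> \<Longrightarrow> finite (C - W)"
    "\<And>P. P \<in> \<P> \<Longrightarrow> infinite (P \<inter> C \<inter> E)"
    "\<And>P. P \<in> \<P> \<Longrightarrow> infinite (P \<inter> C - E)"
proof -
  define \<V> where "\<V> = {\<Inter>\<U> | \<U>. finite \<U> \<and> \<U> \<subseteq> \<W>}"
  let ?Q = "splitting_conditions \<V>" and ?r = "splitting_order \<V>"
  have V_inf: "infinite (P \<inter> V)" if "P \<in> \<P>" "V \<in> \<V>" for P V
    using inf[of _ P] that unfolding \<V>_def by blast
  have V_Int: "V \<inter> W \<in> \<V>" if VW: "V \<in> \<V>" "W \<in> \<V>" for V W
  proof -
    obtain \<U> \<U>' where U: "V = \<Inter>\<U>" "finite \<U>" "\<U> \<subseteq> \<W>" "W = \<Inter>\<U>'" "finite \<U>'" "\<U>' \<subseteq> \<W>"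
      using VW unfolding \<V>_def mem_Collect_eq by metis
    have "V \<inter> W = \<Inter>(\<U> \<union> \<U>')"
      by (simp add: U Inter_Un_distrib)
    moreover have "finite (\<U> \<union> \<U>')" "\<U> \<union> \<U>' \<subseteq> \<W>"
      using U by simp_all
    ultimately show ?thesis unfolding \<V>_def mem_Collect_eq by metis
  qed
  have V_sub: "W \<in> \<V>" if "W \<in> \<W>" for W
    unfolding \<V>_def using that by (intro CollectI exI[of _ "{W}"]) simp
  have "UNIV \<in> \<V>"
    unfolding \<V>_def by (intro CollectI exI[of _ "{}"]) simp
  then have "({}, {}, UNIV) \<in> ?Q"
    by (simp add: splitting_conditions_def)
  then have "?Q \<noteq> {}" by blast
  obtain e :: "nat set \<times> nat set \<times> nat set \<Rightarrow> nat set" where "inj e"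
    using inj_encoding_of_triples by blast
  then have MP: "martin_property ?Q ?r"
    using MA \<open>?Q \<noteq> {}\<close> partial_order_splitting ccc_splitting[OF V_Int]
    by (intro martin_property_of_encoding)
  define inside where "inside W = {(s, t, V) \<in> ?Q. V \<subseteq> W}" for W
  define meets where "meets = (\<lambda>(P, n). {(s, t, V) \<in> ?Q. \<exists>k>n. k \<in> P \<inter> t})"
  define avoids where "avoids = (\<lambda>(P, n). {(s, t, V) \<in> ?Q. \<exists>k>n. k \<in> P \<inter> (s - t)})"
  define \<D> where "\<D> = inside ` \<W> \<union> (meets ` (\<P> \<times> (UNIV :: nat set)) \<union> avoids ` (\<P> \<times> (UNIV :: nat set)))"
  have "small \<D>"
    unfolding \<D>_def by (intro small_Un small_image small_Times small_\<W> small_\<P> small_nat)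
  moreover have "dense_in_order ?Q ?r (inside W)" if "W \<in> \<W>" for W
    unfolding dense_in_order_def
  proof (intro conjI ballI)
    fix p assume "p \<in> ?Q"
    then obtain s t V where p: "p = (s, t, V)" "finite s" "t \<subseteq> s" "V \<in> \<V>"
      by (auto simp: splitting_conditions_def)
    then have "(s, t, V \<inter> W) \<in> inside W" "((s, t, V \<inter> W), p) \<in> ?r"
      using V_Int V_sub that by (auto simp: inside_def splitting_conditions_def splitting_order_def)
    then show "\<exists>d\<in>inside W. (d, p) \<in> ?r" by blast
  qed (auto simp: inside_def)
  moreover have "dense_in_order ?Q ?r (meets (P, n)) \<and> dense_in_order ?Q ?r (avoids (P, n))"
    if "P \<in> \<P>" for P n
    unfolding dense_in_order_def
  proof (intro conjI ballI)
    fix p assume "p \<in> ?Q"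
    then obtain s t V where p: "p = (s, t, V)" "finite s" "t \<subseteq> s" "V \<in> \<V>"
      by (auto simp: splitting_conditions_def)
    have "infinite (P \<inter> V - s)"
      using V_inf[OF that p(4)] p(2) by simp
    then obtain k where k: "k > n" "k \<in> P" "k \<in> V" "k \<notin> s"
      unfolding infinite_nat_iff_unbounded by blast
    have "(insert k s, insert k t, V) \<in> meets (P, n)" "((insert k s, insert k t, V), p) \<in> ?r"
      using k p by (auto simp: meets_def splitting_conditions_def splitting_order_def)
    then show "\<exists>d\<in>meets (P, n). (d, p) \<in> ?r" by blast
    have "(insert k s, t, V) \<in> avoids (P, n)" "((insert k s, t, V), p) \<in> ?r"
      using k p by (auto simp: avoids_def splitting_conditions_def splitting_order_def)
    then show "\<exists>d\<in>avoids (P, n). (d, p) \<in> ?r" by blast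
  qed (auto simp: meets_def avoids_def)
  ultimately have "small \<D> \<and> (\<forall>D\<in>\<D>. dense_in_order ?Q ?r D)"
    by (auto simp: \<D>_def)
  then obtain G where G: "filter_in_order ?Q ?r G" and "\<forall>D\<in>\<D>. G \<inter> D \<noteq> {}"
    using MP unfolding martin_property_def by meson
  then have GD: "G \<inter> D \<noteq> {}" if "D \<in> \<D>" for D
    using that by blast
  define C where "C = {k. \<exists>(s, t, V)\<in>G. k \<in> s}"
  define E where "E = {k. \<exists>(s, t, V)\<in>G. k \<in> t}"
  \<comment> \<open>the decisions made by two conditions of the generic filter agree\<close>
  have common: "\<exists>s'' t'' V''. s \<subseteq> s'' \<and> s'' - s \<subseteq> V \<and> t'' \<inter> s = t \<and> s' \<subseteq> s'' \<and> t'' \<inter> s' = t'"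
    if in_G: "(s, t, V) \<in> G" "(s', t', V') \<in> G" for s t V s' t' V'
  proof -
    obtain x where "(x, (s, t, V)) \<in> ?r" "(x, (s', t', V')) \<in> ?r"
      using in_G G unfolding filter_in_order_def by metis
    then show ?thesis
      by (cases x) (auto simp: splitting_order_def)
  qed
  show ?thesis
  proof (rule that[of C E])
    fix W assume "W \<in> \<W>"
    then obtain s t V where st: "(s, t, V) \<in> G" "V \<subseteq> W" "finite s"
      using GD[of "inside W"] by (auto simp: \<D>_def inside_def splitting_conditions_def)
    have "C - W \<subseteq> s"
    proof
      fix k assume k: "k \<in> C - W"
      then obtain s' t' V' where st': "(s', t', V') \<in> G" "k \<in> s'"
        by (auto simp: C_def)
      obtain s'' where "s' \<subseteq> s''" "s'' - s \<subseteq> V"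
        using common[OF st(1) st'(1)] by metis
      then show "k \<in> s"
        using st(2) st'(2) k by auto
    qed
    then show "finite (C - W)"
      using st(3) finite_subset by blast
  next
    fix P assume P: "P \<in> \<P>"
    show "infinite (P \<inter> C \<inter> E)"
      unfolding infinite_nat_iff_unbounded
    proof
      fix n
      have "G \<inter> meets (P, n) \<noteq> {}"
        using P by (intro GD) (auto simp: \<D>_def)
      then obtain s t V k where "(s, t, V) \<in> G" "t \<subseteq> s" "k > n" "k \<in> P" "k \<in> t"
        by (auto simp: meets_def splitting_conditions_def)
      then show "\<exists>k>n. k \<in> P \<inter> C \<inter> E"
        by (auto simp: C_def E_def)
    qed
    show "infinite (P \<inter> C - E)"
      unfolding infinite_nat_iff_unbounded
    proof
      fix n
      have "G \<inter> avoids (P, n) \<noteq> {}"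
        using P by (intro GD) (auto simp: \<D>_def)
      then obtain s t V k where st: "(s, t, V) \<in> G" "n < k" "k \<in> P" "k \<in> s" "k \<notin> t"
        by (auto simp: avoids_def)
      have "k \<notin> E"
      proof
        assume "k \<in> E"
        then obtain s' t' V' where st': "(s', t', V') \<in> G" "k \<in> t'"
          by (auto simp: E_def)
        obtain t'' where "t'' \<inter> s = t" "t'' \<inter> s' = t'"
          using common[OF st(1) st'(1)] by metis
        then show False
          using st(4,5) st'(2) by auto
      qed
      then show "\<exists>k>n. k \<in> P \<inter> C - E"
        using st by (auto simp: C_def)
    qed
  qed
qed

lemma MA_pseudointersection:
  assumes MA: "Martins_axiom" and "small \<W>" "small \<P>"
    and "\<And>\<U> P. finite \<U> \<Longrightarrow> \<U> \<subseteq> \<W> \<Longrightarrow> P \<in> \<P> \<Longrightarrow> infinite (P \<inter> \<Inter>\<U>)"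
  obtains C :: "nat set" where
    "\<And>W. W \<in> \<W> \<Longrightarrow> finite (C - W)" "\<And>P. P \<in> \<P> \<Longrightarrow> infinite (P \<inter> C)"
proof -
  obtain C E where "\<And>W. W \<in> \<W> \<Longrightarrow> finite (C - W)" "\<And>P. P \<in> \<P> \<Longrightarrow> infinite (P \<inter> C \<inter> E)"
    using MA_splitting_pseudointersection[OF assms(1-3)] assms(4) by metis
  then show ?thesis
    using that[of C] by (metis finite_Int)
qed

lemma MA_splitting_set:
  assumes MA: "Martins_axiom" and "small \<P>" and inf: "\<And>P. P \<in> \<P> \<Longrightarrow> infinite P"
  obtains S :: "nat set" where
    "\<And>P. P \<in> \<P> \<Longrightarrow> infinite (P \<inter> S)" "\<And>P. P \<in> \<P> \<Longrightarrow> infinite (P - S)"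
proof -
  have "infinite (P \<inter> \<Inter>\<U>)" if "\<U> \<subseteq> {}" "P \<in> \<P>" for \<U> P
    using that inf by simp
  then obtain C E where CE: "\<And>P. P \<in> \<P> \<Longrightarrow> infinite (P \<inter> C \<inter> E)" "\<And>P. P \<in> \<P> \<Longrightarrow> infinite (P \<inter> C - E)"
    using MA_splitting_pseudointersection[OF MA small_countable[OF countable_empty] assms(2)] by metis
  show ?thesis
  proof (rule that)
    fix P assume P: "P \<in> \<P>"
    show "infinite (P \<inter> E)"
      by (rule infinite_super[OF _ CE(1)[OF P]]) auto
    show "infinite (P - E)"
      by (rule infinite_super[OF _ CE(2)[OF P]]) auto
  qed
qed

section \<open>Algebras of pairs of a set of naturals and a clopen set\<close>

definition clopenin :: "'a topology \<Rightarrow> 'a set \<Rightarrow> bool"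
  where "clopenin X b \<longleftrightarrow> openin X b \<and> closedin X b"

lemma clopenin_subset: "clopenin X b \<Longrightarrow> b \<subseteq> topspace X"
  by (simp add: clopenin_def openin_subset)

text \<open>
  Subalgebras of the product of the power set of \<open>\<omega>\<close> and the clopen algebra of \<open>X\<close>; they serve as
  approximations to the graph of a homomorphism.
\<close>

definition pairing_algebra :: "'a topology \<Rightarrow> (nat set \<times> 'a set) set \<Rightarrow> bool"
  where "pairing_algebra X R \<longleftrightarrow>
    ({}, {}) \<in> R \<and>
    (\<forall>A b. (A, b) \<in> R \<longrightarrow> clopenin X b \<and> (- A, topspace X - b) \<in> R) \<and>
    (\<forall>A b A' b'. (A, b) \<in> R \<longrightarrow> (A', b') \<in> R \<longrightarrow> (A \<inter> A', b \<inter> b') \<in> R)"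

text \<open>
  Read modulo the sets almost disjoint from \<open>C\<close>, a faithful algebra is the graph of an isomorphism
  between a subalgebra of the power set of \<open>C\<close> modulo finite sets and a subalgebra of the clopen
  algebra: the pair \<open>(A - A', b - b')\<close> shows that \<open>b\<close> is determined by \<open>A\<close> and conversely.
\<close>

definition faithful :: "nat set \<Rightarrow> (nat set \<times> 'a set) set \<Rightarrow> bool"
  where "faithful C R \<longleftrightarrow> (\<forall>A b. (A, b) \<in> R \<longrightarrow> (infinite (A \<inter> C) \<longleftrightarrow> b \<noteq> {}))"

lemma pairing_empty: "pairing_algebra X R \<Longrightarrow> ({}, {}) \<in> R"
  and pairing_clopenin: "pairing_algebra X R \<Longrightarrow> (A, b) \<in> R \<Longrightarrow> clopenin X b"
  and pairing_Compl: "pairing_algebra X R \<Longrightarrow> (A, b) \<in> R \<Longrightarrow> (- A, topspace X - b) \<in> R"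
  and pairing_Int: "pairing_algebra X R \<Longrightarrow> (A, b) \<in> R \<Longrightarrow> (A', b') \<in> R \<Longrightarrow> (A \<inter> A', b \<inter> b') \<in> R"
  by (auto simp: pairing_algebra_def)

lemma pairing_subset: "pairing_algebra X R \<Longrightarrow> (A, b) \<in> R \<Longrightarrow> b \<subseteq> topspace X"
  by (meson pairing_clopenin clopenin_subset)

lemma pairing_UNIV: "pairing_algebra X R \<Longrightarrow> (UNIV, topspace X) \<in> R"
  using pairing_Compl[OF _ pairing_empty] by fastforce

lemma pairing_Diff:
  assumes "pairing_algebra X R" "(A, b) \<in> R" "(A', b') \<in> R"
  shows "(A - A', b - b') \<in> R"
proof -
  have "b \<inter> (topspace X - b') = b - b'"
    using pairing_subset[OF assms(1,2)] by auto
  then show ?thesis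
    using pairing_Int[OF assms(1,2) pairing_Compl[OF assms(1,3)]] by (simp add: Diff_eq)
qed

lemma pairing_Un:
  assumes "pairing_algebra X R" "(A, b) \<in> R" "(A', b') \<in> R"
  shows "(A \<union> A', b \<union> b') \<in> R"
proof -
  have "topspace X - (topspace X - b - b') = b \<union> b'"
    using pairing_subset[OF assms(1,2)] pairing_subset[OF assms(1,3)] by auto
  then show ?thesis
    using pairing_Compl[OF assms(1) pairing_Diff[OF assms(1) pairing_Compl[OF assms(1,2)] assms(3)]]
    by simp
qed

text \<open>
  The algebra generated by \<open>R\<close> and the pair \<open>(A, b)\<close>.
\<close>

definition adjoin :: "(nat set \<times> 'a set) set \<Rightarrow> nat set \<Rightarrow> 'a set \<Rightarrow> (nat set \<times> 'a set) set"
  where "adjoin R A b =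
    (\<lambda>((E, c), (E', c')). ((E \<inter> A) \<union> (E' - A), (c \<inter> b) \<union> (c' - b))) ` (R \<times> R)"

lemma adjoinI:
  "(E, c) \<in> R \<Longrightarrow> (E', c') \<in> R \<Longrightarrow> F = (E \<inter> A) \<union> (E' - A) \<Longrightarrow> d = (c \<inter> b) \<union> (c' - b)
    \<Longrightarrow> (F, d) \<in> adjoin R A b"
  unfolding adjoin_def by (rule image_eqI[of _ _ "((E, c), (E', c'))"]) auto

lemma adjoinE:
  assumes "(F, d) \<in> adjoin R A b"
  obtains E c E' c' where "(E, c) \<in> R" "(E', c') \<in> R" "F = (E \<inter> A) \<union> (E' - A)" "d = (c \<inter> b) \<union> (c' - b)"
  using assms unfolding adjoin_def by auto

lemma subset_adjoin: "R \<subseteq> adjoin R A b"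
proof
  fix x assume "x \<in> R"
  then show "x \<in> adjoin R A b"
    by (cases x) (auto intro: adjoinI)
qed

lemma mem_adjoin:
  assumes "pairing_algebra X R" "clopenin X b"
  shows "(A, b) \<in> adjoin R A b"
  using clopenin_subset[OF assms(2)]
  by (intro adjoinI[OF pairing_UNIV[OF assms(1)] pairing_empty[OF assms(1)]]) auto

lemma clopenin_mix:
  "clopenin X b \<Longrightarrow> clopenin X c \<Longrightarrow> clopenin X c' \<Longrightarrow> clopenin X ((c \<inter> b) \<union> (c' - b))"
  unfolding clopenin_def by (intro conjI openin_Un closedin_Un openin_Int closedin_Int openin_diff closedin_diff; blast)

lemma pairing_adjoin:
  assumes R: "pairing_algebra X R" and b: "clopenin X b"
  shows "pairing_algebra X (adjoin R A b)"
  unfolding pairing_algebra_def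
proof (intro conjI allI impI)
  show "({}, {}) \<in> adjoin R A b"
    using subset_adjoin pairing_empty[OF R] by blast
next
  fix F d assume "(F, d) \<in> adjoin R A b"
  then obtain E c E' c' where *: "(E, c) \<in> R" "(E', c') \<in> R"
    "F = (E \<inter> A) \<union> (E' - A)" "d = (c \<inter> b) \<union> (c' - b)"
    by (rule adjoinE)
  show "clopenin X d"
    unfolding *(4) by (rule clopenin_mix[OF b pairing_clopenin[OF R *(1)] pairing_clopenin[OF R *(2)]])
  show "(- F, topspace X - d) \<in> adjoin R A b"
    using clopenin_subset[OF b]
    by (intro adjoinI[OF pairing_Compl[OF R *(1)] pairing_Compl[OF R *(2)]]) (auto simp: *(3,4))
next
  fix F d F' d' assume "(F, d) \<in> adjoin R A b" "(F', d') \<in> adjoin R A b"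
  then obtain E c E' c' D e D' e' where *: "(E, c) \<in> R" "(E', c') \<in> R" "(D, e) \<in> R" "(D', e') \<in> R"
    "F = (E \<inter> A) \<union> (E' - A)" "d = (c \<inter> b) \<union> (c' - b)"
    "F' = (D \<inter> A) \<union> (D' - A)" "d' = (e \<inter> b) \<union> (e' - b)"
    by (elim adjoinE)
  show "(F \<inter> F', d \<inter> d') \<in> adjoin R A b"
    by (intro adjoinI[OF pairing_Int[OF R *(1,3)] pairing_Int[OF R *(2,4)]]) (auto simp: *(5-8))
qed

lemma card_adjoin:
  assumes "infinite K" "|R| \<le>o |K|"
  shows "|adjoin R A b| \<le>o |K|"
proof -
  have "|R \<times> R| \<le>o |K|"
    using assms card_of_Card_order by (intro card_of_Times_ordLeq_infinite_Field) (auto simp: Field_card_of)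
  then show ?thesis
    unfolding adjoin_def using card_of_image ordLeq_transitive by blast
qed

lemma small_adjoin: "small R \<Longrightarrow> small (adjoin R A b)"
  unfolding adjoin_def by (intro small_image small_Times)

lemma pairing_Union_chain:
  assumes "\<R> \<noteq> {}" and pair: "\<And>R. R \<in> \<R> \<Longrightarrow> pairing_algebra X R"
    and chain: "\<And>R S. R \<in> \<R> \<Longrightarrow> S \<in> \<R> \<Longrightarrow> R \<subseteq> S \<or> S \<subseteq> R"
  shows "pairing_algebra X (\<Union>\<R>)"
  unfolding pairing_algebra_def
proof (intro conjI allI impI)
  show "({}, {}) \<in> \<Union>\<R>"
    using assms(1) pair pairing_empty by blast
next
  fix A b assume "(A, b) \<in> \<Union>\<R>"
  then obtain R where R: "R \<in> \<R>" "(A, b) \<in> R" by blast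
  show "clopenin X b"
    by (rule pairing_clopenin[OF pair[OF R(1)] R(2)])
  show "(- A, topspace X - b) \<in> \<Union>\<R>"
    by (rule UnionI[OF R(1) pairing_Compl[OF pair[OF R(1)] R(2)]])
next
  fix A b A' b' assume "(A, b) \<in> \<Union>\<R>" "(A', b') \<in> \<Union>\<R>"
  then obtain R S where RS: "R \<in> \<R>" "(A, b) \<in> R" "S \<in> \<R>" "(A', b') \<in> S"
    by (elim UnionE)
  then obtain Q where Q: "Q \<in> \<R>" "(A, b) \<in> Q" "(A', b') \<in> Q"
    using chain[OF RS(1,3)] by (metis subsetD)
  show "(A \<inter> A', b \<inter> b') \<in> \<Union>\<R>"
    by (rule UnionI[OF Q(1) pairing_Int[OF pair[OF Q(1)] Q(2,3)]])
qed

lemma pairing_trivial: "pairing_algebra X {({}, {}), (UNIV, topspace X)}"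
  by (auto simp: pairing_algebra_def clopenin_def)

section \<open>Extending a faithful algebra\<close>

text \<open>
  When a new pair \<open>(A, b)\<close> can be made faithful by shrinking \<open>C\<close>.  If \<open>c \<inter> b\<close> is empty, then \<open>E \<inter> A\<close>
  has to become finite, and if \<open>c - b\<close> is empty, then \<open>E - A\<close> has to; these are promises for the new
  pseudointersection.  The two hypotheses say that \<open>C\<close> has enough points for the intersections that
  have to stay infinite, and the promises do not take them away: as \<open>R\<close> is an algebra, the points
  excluded by finitely many promises lie in \<open>E \<inter> A\<close> or \<open>E' - A\<close> for just one pair of each kind, and
  \<open>d \<inter> b\<close> does not change when \<open>c\<close> is removed from \<open>d\<close>.
\<close>

lemma faithful_adjoin:
  fixes A C :: "nat set"
  assumes MA: "Martins_axiom" and R: "pairing_algebra X R" "small R" and b: "clopenin X b"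
    and inside: "\<And>E c. (E, c) \<in> R \<Longrightarrow> c \<inter> b \<noteq> {} \<Longrightarrow> infinite (E \<inter> C \<inter> A)"
    and outside: "\<And>E c. (E, c) \<in> R \<Longrightarrow> c - b \<noteq> {} \<Longrightarrow> infinite (E \<inter> C - A)"
  obtains C' where "finite (C' - C)" "faithful C' (adjoin R A b)"
proof -
  define \<W> where "\<W> = {C} \<union> ({- (E \<inter> A) | E c. (E, c) \<in> R \<and> c \<inter> b = {}}
    \<union> {- (E - A) | E c. (E, c) \<in> R \<and> c - b = {}})"
  define \<P> where "\<P> = {E \<inter> A | E c. (E, c) \<in> R \<and> c \<inter> b \<noteq> {}}
    \<union> {E - A | E c. (E, c) \<in> R \<and> c - b \<noteq> {}}"
  have "small \<P>"
    unfolding \<P>_def by (intro small_Un small_image_pairs R)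
  moreover have "small \<W>"
    unfolding \<W>_def by (intro small_Un small_image_pairs R) (simp add: small_countable)
  moreover have "infinite (P \<inter> \<Inter>\<U>)" if "finite \<U>" "\<U> \<subseteq> \<W>" "P \<in> \<P>" for \<U> P
  proof -
    \<comment> \<open>one promise of each kind implies all promises in \<open>\<U>\<close>, by taking unions in \<open>R\<close>\<close>
    have "\<exists>E c E' c'. (E, c) \<in> R \<and> (E', c') \<in> R \<and> c \<inter> b = {} \<and> c' - b = {}
      \<and> C - (E \<inter> A) - (E' - A) \<subseteq> \<Inter>\<U>"
      using \<open>finite \<U>\<close> \<open>\<U> \<subseteq> \<W>\<close>
    proof (induction \<U>)
      case empty
      then show ?case
        using pairing_empty[OF R(1)] by (intro exI[of _ "{}"]) simp
    next
      case (insert W \<U>)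
      then obtain E c E' c' where *: "(E, c) \<in> R" "(E', c') \<in> R" "c \<inter> b = {}" "c' - b = {}"
        "C - (E \<inter> A) - (E' - A) \<subseteq> \<Inter>\<U>" by auto
      have "W \<in> \<W>" using insert.prems by simp
      then consider "W = C" | D d where "(D, d) \<in> R" "d \<inter> b = {}" "W = - (D \<inter> A)"
        | D d where "(D, d) \<in> R" "d - b = {}" "W = - (D - A)"
        unfolding \<W>_def Un_iff mem_Collect_eq singleton_iff by metis
      then show ?case
      proof cases
        case 1
        then show ?thesis using * by (intro exI[of _ E] exI[of _ c] exI[of _ E'] exI[of _ c']) auto
      next
        case (2 D d)
        then show ?thesis
          using * pairing_Un[OF R(1) *(1) 2(1)]
          by (intro exI[of _ "E \<union> D"] exI[of _ "c \<union> d"] exI[of _ E'] exI[of _ c']) auto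
      next
        case (3 D d)
        then show ?thesis
          using * pairing_Un[OF R(1) *(2) 3(1)]
          by (intro exI[of _ E] exI[of _ c] exI[of _ "E' \<union> D"] exI[of _ "c' \<union> d"]) auto
      qed
    qed
    then obtain E c E' c' where *: "(E, c) \<in> R" "(E', c') \<in> R" "c \<inter> b = {}" "c' - b = {}"
      "C - (E \<inter> A) - (E' - A) \<subseteq> \<Inter>\<U>"
      by blast
    consider D d where "(D, d) \<in> R" "d \<inter> b \<noteq> {}" "P = D \<inter> A"
      | D d where "(D, d) \<in> R" "d - b \<noteq> {}" "P = D - A"
      using \<open>P \<in> \<P>\<close> unfolding \<P>_def Un_iff mem_Collect_eq by metis
    then show ?thesis
    proof cases
      case (1 D d)
      have "(d - c) \<inter> b \<noteq> {}"
        using 1(2) *(3) by auto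
      then have "infinite ((D - E) \<inter> C \<inter> A)"
        using inside[OF pairing_Diff[OF R(1) 1(1) *(1)]] by simp
      moreover have "(D - E) \<inter> C \<inter> A \<subseteq> P \<inter> \<Inter>\<U>"
        using *(5) unfolding 1 by auto
      ultimately show ?thesis
        by (meson infinite_super)
    next
      case (2 D d)
      have "(d - c') - b \<noteq> {}"
        using 2(2) *(4) by auto
      then have "infinite ((D - E') \<inter> C - A)"
        using outside[OF pairing_Diff[OF R(1) 2(1) *(2)]] by simp
      moreover have "(D - E') \<inter> C - A \<subseteq> P \<inter> \<Inter>\<U>"
        using *(5) unfolding 2 by auto
      ultimately show ?thesis
        by (meson infinite_super)
    qed
  qed
  ultimately obtain C' where C': "\<And>W. W \<in> \<W> \<Longrightarrow> finite (C' - W)" "\<And>P. P \<in> \<P> \<Longrightarrow> infinite (P \<inter> C')"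
    using MA_pseudointersection[OF MA, of \<W> \<P>] by metis
  have "faithful C' (adjoin R A b)"
    unfolding faithful_def
  proof (intro allI impI)
    fix F d assume "(F, d) \<in> adjoin R A b"
    then obtain E c E' c' where *: "(E, c) \<in> R" "(E', c') \<in> R"
      "F = (E \<inter> A) \<union> (E' - A)" "d = (c \<inter> b) \<union> (c' - b)"
      by (rule adjoinE)
    have F: "F \<inter> C' = (E \<inter> A \<inter> C') \<union> ((E' - A) \<inter> C')"
      by (auto simp: *)
    have 1: "infinite (E \<inter> A \<inter> C') \<longleftrightarrow> c \<inter> b \<noteq> {}"
    proof (cases "c \<inter> b = {}")
      case True
      then have "- (E \<inter> A) \<in> \<W>" using *(1,2) unfolding \<W>_def Un_iff mem_Collect_eq by metis
      from C'(1)[OF this] show ?thesis using True by (simp add: Diff_eq Int_commute)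
    next
      case False
      then have "E \<inter> A \<in> \<P>" using *(1,2) unfolding \<P>_def Un_iff mem_Collect_eq by metis
      from C'(2)[OF this] show ?thesis using False by simp
    qed
    have 2: "infinite ((E' - A) \<inter> C') \<longleftrightarrow> c' - b \<noteq> {}"
    proof (cases "c' - b = {}")
      case True
      then have "- (E' - A) \<in> \<W>" using *(1,2) unfolding \<W>_def Un_iff mem_Collect_eq by metis
      from C'(1)[OF this] have "finite (C' \<inter> (E' - A))" by (simp only: Diff_eq double_complement)
      then show ?thesis using True by (simp add: Int_commute)
    next
      case False
      then have "E' - A \<in> \<P>" using *(1,2) unfolding \<P>_def Un_iff mem_Collect_eq by metis
      from C'(2)[OF this] show ?thesis using False by simp
    qed
    show "infinite (F \<inter> C') \<longleftrightarrow> d \<noteq> {}"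
      unfolding F using 1 2 *(4) by auto
  qed
  moreover have "finite (C' - C)"
    using C'(1) by (simp add: \<W>_def)
  ultimately show ?thesis using that by blast
qed

text \<open>
  A set \<open>A\<close> that splits all infinite sets \<open>E \<inter> C\<close> satisfies the hypotheses of \<open>faithful_adjoin\<close>
  for every clopen \<open>b\<close>.
\<close>

lemma faithful_adjoin_clopen:
  assumes MA: "Martins_axiom" and R: "pairing_algebra X R" "small R" "faithful C R" and b: "clopenin X b"
  obtains A C' where "finite (C' - C)" "faithful C' (adjoin R A b)"
proof -
  define \<P> where "\<P> = {E \<inter> C | E c. (E, c) \<in> R \<and> c \<noteq> {}}"
  have "small \<P>"
    unfolding \<P>_def by (intro small_image_pairs R)
  moreover have "infinite P" if "P \<in> \<P>" for P
    using R(3) that unfolding \<P>_def faithful_def by blast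
  ultimately obtain A where A: "\<And>P. P \<in> \<P> \<Longrightarrow> infinite (P \<inter> A)" "\<And>P. P \<in> \<P> \<Longrightarrow> infinite (P - A)"
    using MA_splitting_set[OF MA, of \<P>] by metis
  have P: "E \<inter> C \<in> \<P>" if "(E, c) \<in> R" "c \<noteq> {}" for E c
    using that unfolding \<P>_def by blast
  have "infinite (E \<inter> C \<inter> A)" if "(E, c) \<in> R" "c \<inter> b \<noteq> {}" for E c
    using A(1)[OF P[OF that(1)]] that(2) by auto
  moreover have "infinite (E \<inter> C - A)" if "(E, c) \<in> R" "c - b \<noteq> {}" for E c
    using A(2)[OF P[OF that(1)]] that(2) by auto
  ultimately show ?thesis
    using faithful_adjoin[OF MA R(1,2) b, of C A] that by metis
qed

text \<open>
  Here \<open>b\<close> is the complement of the closure of the union of \<open>\<O>\<close>, the open sets that the value of \<open>A\<close>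
  must avoid.  If \<open>c - b\<close> is nonempty, then the open set \<open>c\<close> meets some \<open>c' \<in> \<O>\<close>; the pair with
  second component \<open>c \<inter> c'\<close> has infinitely many points in \<open>C\<close>, and almost all of them are outside \<open>A\<close>.
\<close>

lemma faithful_adjoin_set:
  assumes MA: "Martins_axiom" and ED: "extremally_disconnected_space X"
    and R: "pairing_algebra X R" "small R" "faithful C R"
  obtains b C' where "clopenin X b" "finite (C' - C)" "faithful C' (adjoin R A b)"
proof -
  define \<O> where "\<O> = {c. \<exists>E. (E, c) \<in> R \<and> finite (E \<inter> C \<inter> A)}"
  define b where "b = topspace X - X closure_of \<Union>\<O>"
  have open_\<O>: "openin X c" if "c \<in> \<O>" for c
    using that pairing_clopenin[OF R(1)] by (auto simp: \<O>_def clopenin_def)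
  then have "openin X (X closure_of \<Union>\<O>)"
    using ED openin_Union[of \<O> X] by (auto simp: extremally_disconnected_space_def)
  then have b: "clopenin X b"
    unfolding clopenin_def b_def by (simp add: closedin_diff openin_diff)
  have "infinite (E \<inter> C \<inter> A)" if "(E, c) \<in> R" "c \<inter> b \<noteq> {}" for E c
  proof
    assume "finite (E \<inter> C \<inter> A)"
    then have "c \<in> \<O>" using that(1) by (auto simp: \<O>_def)
    moreover have "\<Union>\<O> \<subseteq> X closure_of \<Union>\<O>"
      using open_\<O> by (intro closure_of_subset) (auto dest: openin_subset)
    ultimately show False using that(2) by (auto simp: b_def)
  qed
  moreover have "infinite (E \<inter> C - A)" if Ec: "(E, c) \<in> R" "c - b \<noteq> {}" for E c
  proof -
    have "openin X c"
      using pairing_clopenin[OF R(1) Ec(1)] by (simp add: clopenin_def)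
    moreover have "c \<inter> X closure_of \<Union>\<O> \<noteq> {}"
      using Ec(2) pairing_subset[OF R(1) Ec(1)] by (auto simp: b_def)
    ultimately have "c \<inter> \<Union>\<O> \<noteq> {}"
      by (simp add: openin_Int_closure_of_eq_empty)
    then obtain c' E' where c': "(E', c') \<in> R" "finite (E' \<inter> C \<inter> A)" "c \<inter> c' \<noteq> {}"
      by (auto simp: \<O>_def)
    have "infinite (E \<inter> E' \<inter> C)"
      using pairing_Int[OF R(1) Ec(1) c'(1)] R(3) c'(3) by (auto simp: faithful_def)
    then have "infinite (E \<inter> E' \<inter> C - (E' \<inter> C \<inter> A))"
      using c'(2) by simp
    then show ?thesis
      by (rule infinite_super[rotated]) auto
  qed
  ultimately show ?thesis
    using faithful_adjoin[OF MA R(1,2) b, of C A] b that by metis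
qed

text \<open>
  Let \<open>S\<close> split the sets \<open>E \<inter> C \<inter> M\<close> as well as the preimages under \<open>g\<close> of the sets
  \<open>E \<inter> C \<inter> g ` M\<close>.  From \<open>M\<close> only the points in \<open>S\<close> are kept, and from \<open>g ` M\<close> only the images of
  points not in \<open>S\<close>.  No point and its image are both kept, but every infinite \<open>E \<inter> C\<close> retains
  infinitely many points inside \<open>M\<close>, inside \<open>g ` M\<close>, or outside both.
\<close>

lemma faithful_displace:
  fixes C M :: "nat set"
  assumes MA: "Martins_axiom" and R: "small R" "faithful C R"
    and g: "inj_on g M" "g ` M \<inter> M = {}"
  obtains C' where "C' \<subseteq> C" "faithful C' R" "{k \<in> M \<inter> C'. g k \<in> C'} = {}"
proof -
  define \<P> where "\<P> = {E \<inter> C \<inter> M | E c. (E, c) \<in> R \<and> infinite (E \<inter> C \<inter> M)}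
    \<union> {{k \<in> M. g k \<in> E \<inter> C} | E c. (E, c) \<in> R \<and> infinite {k \<in> M. g k \<in> E \<inter> C}}"
  have "small \<P>"
    unfolding \<P>_def by (intro small_Un small_image_pairs R)
  moreover have "infinite P" if "P \<in> \<P>" for P
    using that unfolding \<P>_def by blast
  ultimately obtain S where S: "\<And>P. P \<in> \<P> \<Longrightarrow> infinite (P \<inter> S)" "\<And>P. P \<in> \<P> \<Longrightarrow> infinite (P - S)"
    using MA_splitting_set[OF MA, of \<P>] by metis
  define C' where "C' = C - (M - S) - g ` (M \<inter> S)"
  have "infinite (E \<inter> C')" if Ec: "(E, c) \<in> R" "infinite (E \<inter> C)" for E c
  proof -
    have "E \<inter> C = (E \<inter> C \<inter> M) \<union> (E \<inter> C \<inter> g ` M) \<union> (E \<inter> C - M - g ` M)"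
      by auto
    then consider "infinite (E \<inter> C \<inter> M)" | "infinite (E \<inter> C \<inter> g ` M)" | "infinite (E \<inter> C - M - g ` M)"
      using Ec(2) by (metis finite_UnI)
    then show ?thesis
    proof cases
      case 1
      then have "E \<inter> C \<inter> M \<in> \<P>" using Ec(1) unfolding \<P>_def by blast
      then have "infinite (E \<inter> C \<inter> M \<inter> S)" by (rule S(1))
      then show ?thesis
        by (rule infinite_super[rotated]) (use g(2) in \<open>auto simp: C'_def\<close>)
    next
      case 2
      have "E \<inter> C \<inter> g ` M = g ` {k \<in> M. g k \<in> E \<inter> C}" by auto
      with 2 have "infinite {k \<in> M. g k \<in> E \<inter> C}" by auto
      then have "{k \<in> M. g k \<in> E \<inter> C} \<in> \<P>" using Ec(1) unfolding \<P>_def by blast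
      then have "infinite ({k \<in> M. g k \<in> E \<inter> C} - S)" by (rule S(2))
      moreover have "inj_on g ({k \<in> M. g k \<in> E \<inter> C} - S)"
        by (rule inj_on_subset[OF g(1)]) auto
      ultimately have "infinite (g ` ({k \<in> M. g k \<in> E \<inter> C} - S))"
        by (simp add: finite_image_iff)
      moreover have "g ` ({k \<in> M. g k \<in> E \<inter> C} - S) \<subseteq> E \<inter> C'"
        using g by (auto simp: C'_def inj_on_def)
      ultimately show ?thesis
        by (meson infinite_super)
    next
      case 3
      then show ?thesis
        by (rule infinite_super[rotated]) (auto simp: C'_def)
    qed
  qed
  moreover have "C' \<subseteq> C" by (auto simp: C'_def)
  moreover have "finite (E \<inter> C')" if "finite (E \<inter> C)" for E
    by (rule finite_subset[OF _ that]) (auto simp: C'_def)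
  ultimately have "faithful C' R"
    using R(2) unfolding faithful_def by metis
  then show ?thesis
    using that[of C'] by (auto simp: C'_def)
qed

text \<open>
  One stage of the recursion: \<open>\<W>\<close> is the set of all earlier \<open>C \<beta>\<close> and \<open>R\<close> the union of the earlier
  algebras.  The bound \<open>K\<close> on the cardinality of \<open>R\<close> is uniform in the earlier
  stages, so the union stays small without an appeal to the regularity of the continuum.
\<close>

lemma approximation_step:
  fixes R :: "(nat set \<times> 'a set) set" and g :: "nat \<Rightarrow> nat" and K :: "'k set"
  assumes MA: "Martins_axiom" and ED: "extremally_disconnected_space X"
    and R: "pairing_algebra X R" "small R" and b: "clopenin X b" and \<W>: "small \<W>"
    and pos: "\<And>\<U> E c. finite \<U> \<Longrightarrow> \<U> \<subseteq> \<W> \<Longrightarrow> (E, c) \<in> R \<Longrightarrow> c \<noteq> {} \<Longrightarrow> infinite (E \<inter> \<Inter>\<U>)"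
    and null: "\<And>E. (E, {}) \<in> R \<Longrightarrow> E = {} \<or> (\<exists>W\<in>\<W>. finite (E \<inter> W))"
    and K: "infinite K" "|R| \<le>o |K|"
  obtains C R' where "\<forall>W\<in>\<W>. finite (C - W)" "pairing_algebra X R'" "faithful C R'" "R \<subseteq> R'"
    "|R'| \<le>o |K|" "\<exists>E. (E, b) \<in> R'" "\<exists>c. (A, c) \<in> R'"
    "inj_on g A \<longrightarrow> g ` A \<inter> A = {} \<longrightarrow> finite {k \<in> A \<inter> C. g k \<in> C}"
proof -
  define \<P> where "\<P> = {E | E c. (E, c) \<in> R \<and> c \<noteq> {}}"
  have "small \<P>"
    unfolding \<P>_def by (intro small_image_pairs R)
  moreover have "infinite (P \<inter> \<Inter>\<U>)" if "finite \<U>" "\<U> \<subseteq> \<W>" "P \<in> \<P>" for \<U> P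
  proof -
    obtain c where "(P, c) \<in> R" "c \<noteq> {}"
      using \<open>P \<in> \<P>\<close> unfolding \<P>_def by blast
    then show ?thesis
      using pos \<open>finite \<U>\<close> \<open>\<U> \<subseteq> \<W>\<close> by metis
  qed
  ultimately obtain C0 where C0: "\<And>W. W \<in> \<W> \<Longrightarrow> finite (C0 - W)" "\<And>P. P \<in> \<P> \<Longrightarrow> infinite (P \<inter> C0)"
    using MA_pseudointersection[OF MA \<W>, of \<P>] by metis
  have "faithful C0 R"
    unfolding faithful_def
  proof (intro allI impI)
    fix E c assume Ec: "(E, c) \<in> R"
    show "infinite (E \<inter> C0) \<longleftrightarrow> c \<noteq> {}"
    proof (cases "c = {}")
      case True
      then consider "E = {}" | W where "W \<in> \<W>" "finite (E \<inter> W)"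
        using null Ec by blast
      then have "finite (E \<inter> C0)"
      proof cases
        case 2
        have "finite ((E \<inter> W) \<union> (C0 - W))" using 2 C0(1) by simp
        then show ?thesis by (rule finite_subset[rotated]) auto
      qed simp
      then show ?thesis using True by simp
    next
      case False
      then have "E \<in> \<P>" using Ec unfolding \<P>_def by blast
      then show ?thesis using C0(2) False by simp
    qed
  qed
  then obtain E C1 where 1: "finite (C1 - C0)" "faithful C1 (adjoin R E b)"
    using faithful_adjoin_clopen[OF MA R _ b] by metis
  define R1 where "R1 = adjoin R E b"
  have R1: "pairing_algebra X R1" "small R1" "faithful C1 R1" "(E, b) \<in> R1"
    using pairing_adjoin[OF R(1) b] small_adjoin[OF R(2)] 1 mem_adjoin[OF R(1) b] by (auto simp: R1_def)
  obtain c C2 where 2: "clopenin X c" "finite (C2 - C1)" "faithful C2 (adjoin R1 A c)"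
    using faithful_adjoin_set[OF MA ED R1(1-3)] by metis
  define R2 where "R2 = adjoin R1 A c"
  have R2: "pairing_algebra X R2" "small R2" "faithful C2 R2" "(A, c) \<in> R2"
    using pairing_adjoin[OF R1(1) 2(1)] small_adjoin[OF R1(2)] 2 mem_adjoin[OF R1(1) 2(1)] by (auto simp: R2_def)
  have "R1 \<subseteq> R2" "R \<subseteq> R1"
    unfolding R1_def R2_def by (rule subset_adjoin)+
  have card: "|R2| \<le>o |K|"
    unfolding R2_def R1_def using K by (intro card_adjoin)
  have "\<exists>C3\<subseteq>C2. faithful C3 R2 \<and> (inj_on g A \<longrightarrow> g ` A \<inter> A = {} \<longrightarrow> finite {k \<in> A \<inter> C3. g k \<in> C3})"
  proof (cases "inj_on g A \<and> g ` A \<inter> A = {}")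
    case True
    then obtain C3 where "C3 \<subseteq> C2" "faithful C3 R2" "{k \<in> A \<inter> C3. g k \<in> C3} = {}"
      using faithful_displace[OF MA R2(2,3)] by metis
    then show ?thesis by (metis finite.emptyI)
  qed (use R2(3) in blast)
  then obtain C3 where 3: "C3 \<subseteq> C2" "faithful C3 R2"
    "inj_on g A \<longrightarrow> g ` A \<inter> A = {} \<longrightarrow> finite {k \<in> A \<inter> C3. g k \<in> C3}"
    by blast
  have "finite (C3 - W)" if "W \<in> \<W>" for W
  proof -
    have "finite ((C2 - C1) \<union> (C1 - C0) \<union> (C0 - W))" using 1(1) 2(2) C0(1)[OF that] by simp
    then show ?thesis by (rule finite_subset[rotated]) (use 3(1) in auto)
  qed
  with that[of C3 R2] R2 3 card \<open>R1 \<subseteq> R2\<close> \<open>R \<subseteq> R1\<close> R1(4) show ?thesis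
    by blast
qed

section \<open>The recursion of length continuum\<close>

text \<open>
  What the recursion produces.  The map \<open>h\<close> is a homomorphism onto the clopen algebra of \<open>X\<close> whose
  kernel is dual to the filter of the tower \<open>C\<close>.
\<close>

locale quotient_tower =
  fixes X :: "'a topology" and C :: "(nat \<Rightarrow> bool) \<Rightarrow> nat set" and h :: "nat set \<Rightarrow> 'a set"
  assumes decreasing: "(\<beta>, \<alpha>) \<in> continuum \<Longrightarrow> finite (C \<alpha> - C \<beta>)"
    and h_clopen: "clopenin X (h M)"
    and h_Compl: "h (- M) = topspace X - h M"
    and h_Int: "h (M \<inter> N) = h M \<inter> h N"
    and h_surj: "clopenin X c \<Longrightarrow> \<exists>M. h M = c"
    and h_null: "h M = {} \<longleftrightarrow> (\<exists>\<alpha>. finite (M \<inter> C \<alpha>))"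
    and displacing: "inj_on g M \<Longrightarrow> g ` M \<inter> M = {} \<Longrightarrow> \<exists>\<alpha>. finite {k \<in> M \<inter> C \<alpha>. g k \<in> C \<alpha>}"
    and nonempty: "topspace X \<noteq> {}"

text \<open>
  The tasks of stage \<open>\<alpha>\<close> are the clopen set \<open>b \<alpha>\<close>, the set \<open>A \<alpha>\<close>, and the partial map \<open>g \<alpha>\<close> on \<open>A \<alpha>\<close>.
\<close>

lemma faithful_tower_exists:
  fixes X :: "'a topology" and b :: "(nat \<Rightarrow> bool) \<Rightarrow> 'a set"
    and A :: "(nat \<Rightarrow> bool) \<Rightarrow> nat set" and g :: "(nat \<Rightarrow> bool) \<Rightarrow> nat \<Rightarrow> nat"
  assumes MA: "Martins_axiom" and ED: "extremally_disconnected_space X"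
    and ne: "topspace X \<noteq> {}" and b: "\<And>\<alpha>. clopenin X (b \<alpha>)"
  shows "\<exists>C R. (\<forall>\<alpha>. pairing_algebra X (R \<alpha>) \<and> faithful (C \<alpha>) (R \<alpha>) \<and> (\<exists>E. (E, b \<alpha>) \<in> R \<alpha>) \<and> (\<exists>c. (A \<alpha>, c) \<in> R \<alpha>) \<and>
      (inj_on (g \<alpha>) (A \<alpha>) \<longrightarrow> g \<alpha> ` A \<alpha> \<inter> A \<alpha> = {} \<longrightarrow> finite {k \<in> A \<alpha> \<inter> C \<alpha>. g \<alpha> k \<in> C \<alpha>})) \<and>
    (\<forall>\<alpha> \<beta>. (\<beta>, \<alpha>) \<in> continuum \<longrightarrow> finite (C \<alpha> - C \<beta>) \<and> R \<beta> \<subseteq> R \<alpha>)"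
proof -
  define K where "K \<alpha> = (UNIV :: nat set) <+> underS continuum \<alpha>" for \<alpha>
  have K: "infinite (K \<alpha>)" "small (K \<alpha>)" for \<alpha>
    using small_nat small_underS infinite_continuum unfolding K_def
    by (simp, intro card_of_Plus_ordLess_infinite_Field Card_order_continuum) (simp_all add: Field_continuum)
  have K_mono: "|K \<beta>| \<le>o |K \<alpha>|" if "\<beta> \<in> underS continuum \<alpha>" for \<alpha> \<beta>
  proof -
    have "underS continuum \<beta> \<subseteq> underS continuum \<alpha>"
      using underS_incr that Well_order_continuum
      by (metis (no_types, lifting) underS_E well_order_on_def linear_order_on_def partial_order_on_def preorder_on_def)
    then show ?thesis
      unfolding K_def by (intro card_of_mono1) (auto simp: Plus_def)
  qed
  define \<Phi> where "\<Phi> f \<alpha> x \<longleftrightarrow> pairing_algebra X (snd x) \<and> faithful (fst x) (snd x) \<and> |snd x| \<le>o |K \<alpha>| \<and>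
      (\<forall>\<beta>\<in>underS continuum \<alpha>. finite (fst x - fst (f \<beta>)) \<and> snd (f \<beta>) \<subseteq> snd x) \<and>
      (\<exists>E. (E, b \<alpha>) \<in> snd x) \<and> (\<exists>c. (A \<alpha>, c) \<in> snd x) \<and>
      (inj_on (g \<alpha>) (A \<alpha>) \<longrightarrow> g \<alpha> ` A \<alpha> \<inter> A \<alpha> = {} \<longrightarrow> finite {k \<in> A \<alpha> \<inter> fst x. g \<alpha> k \<in> fst x})"
    for f :: "(nat \<Rightarrow> bool) \<Rightarrow> nat set \<times> (nat set \<times> 'a set) set" and \<alpha> x
  have "\<exists>f. \<forall>\<alpha>. \<Phi> f \<alpha> (f \<alpha>)"
  proof (rule dependent_wf_choice[OF wf_continuum])
    fix f f' :: "(nat \<Rightarrow> bool) \<Rightarrow> nat set \<times> (nat set \<times> 'a set) set" and \<alpha> x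
    assume "\<And>z. (z, \<alpha>) \<in> continuum - Id \<Longrightarrow> f z = f' z"
    then have "\<forall>\<beta>\<in>underS continuum \<alpha>. f \<beta> = f' \<beta>"
      by (simp add: underS_def)
    then show "\<Phi> f \<alpha> x = \<Phi> f' \<alpha> x"
      by (simp add: \<Phi>_def)
  next
    fix \<alpha> and f :: "(nat \<Rightarrow> bool) \<Rightarrow> nat set \<times> (nat set \<times> 'a set) set"
    assume IH': "\<And>\<beta>. (\<beta>, \<alpha>) \<in> continuum - Id \<Longrightarrow> \<Phi> f \<beta> (f \<beta>)"
    let ?U = "underS continuum \<alpha>"
    have IH: "\<Phi> f \<beta> (f \<beta>)" if "\<beta> \<in> ?U" for \<beta>
      using that by (intro IH') (simp add: underS_def)
    define C where "C \<beta> = fst (f \<beta>)" for \<beta>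
    define R where "R \<beta> = snd (f \<beta>)" for \<beta>
    have pair: "pairing_algebra X (R \<beta>)" and faith: "faithful (C \<beta>) (R \<beta>)" and card: "|R \<beta>| \<le>o |K \<beta>|"
      if "\<beta> \<in> ?U" for \<beta>
      using IH[OF that] by (simp_all add: \<Phi>_def C_def R_def)
    have mono: "finite (C \<gamma> - C \<beta>) \<and> R \<beta> \<subseteq> R \<gamma>" if "\<gamma> \<in> ?U" "(\<beta>, \<gamma>) \<in> continuum" for \<beta> \<gamma>
    proof (cases "\<beta> = \<gamma>")
      case False
      then have "\<beta> \<in> underS continuum \<gamma>" using that(2) by (simp add: underS_def)
      then show ?thesis using IH[OF that(1)] by (simp add: \<Phi>_def C_def R_def)
    qed simp
    \<comment> \<open>the trivial algebra makes the first stage, where there are no earlier algebras, fit\<close>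
    define T where "T = {({}, {}), (UNIV :: nat set, topspace X)}"
    define R0 where "R0 = T \<union> (\<Union>\<beta>\<in>?U. R \<beta>)"
    have T_sub: "T \<subseteq> R \<beta>" if "\<beta> \<in> ?U" for \<beta>
      using pairing_empty[OF pair[OF that]] pairing_UNIV[OF pair[OF that]] by (simp add: T_def)
    have R0_eq: "R0 = \<Union>(insert T (R ` ?U))"
      by (simp add: R0_def)
    have pair0: "pairing_algebra X R0"
      unfolding R0_eq
    proof (rule pairing_Union_chain)
      fix S assume "S \<in> insert T (R ` ?U)"
      then show "pairing_algebra X S" using pair pairing_trivial by (auto simp: T_def)
    next
      fix S S' assume "S \<in> insert T (R ` ?U)" "S' \<in> insert T (R ` ?U)"
      then consider "S = T" "S' = T" | \<beta> where "\<beta> \<in> ?U" "S = T" "S' = R \<beta>"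
        | \<beta> where "\<beta> \<in> ?U" "S = R \<beta>" "S' = T"
        | \<beta> \<gamma> where "\<beta> \<in> ?U" "\<gamma> \<in> ?U" "S = R \<beta>" "S' = R \<gamma>"
        unfolding insert_iff image_iff by metis
      then show "S \<subseteq> S' \<or> S' \<subseteq> S"
      proof cases
        case (4 \<beta> \<gamma>)
        then show ?thesis using mono[of \<beta> \<gamma>] mono[of \<gamma> \<beta>] continuum_linear[of \<beta> \<gamma>] by auto
      qed (simp_all add: T_sub)
    qed simp
    have card0: "|R0| \<le>o |K \<alpha>|"
    proof -
      have "|?U| \<le>o |K \<alpha>|"
        unfolding K_def by (rule card_of_Plus2)
      moreover have "\<forall>\<beta>\<in>?U. |R \<beta>| \<le>o |K \<alpha>|"
        using card K_mono ordLeq_transitive by blast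
      ultimately have "|\<Union>\<beta>\<in>?U. R \<beta>| \<le>o |K \<alpha>|"
        by (intro card_of_UNION_ordLeq_infinite K)
      moreover have "|T| \<le>o |K \<alpha>|"
        using K(1) by (intro ordLess_imp_ordLeq finite_ordLess_infinite card_of_Well_order)
          (simp_all add: T_def Field_card_of)
      ultimately show ?thesis
        unfolding R0_def using K(1) card_of_Card_order
        by (intro card_of_Un_ordLeq_infinite_Field) (simp_all add: Field_card_of)
    qed
    have small0: "small R0"
      using card0 K(2) by (rule ordLeq_ordLess_trans)
    have pos: "infinite (E \<inter> \<Inter>\<U>)" if \<U>: "finite \<U>" "\<U> \<subseteq> C ` ?U" and Ec: "(E, c) \<in> R0" "c \<noteq> {}" for \<U> E c
    proof (cases "?U = {}")
      case True
      then show ?thesis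
        using \<U>(2) Ec by (auto simp: R0_def T_def)
    next
      case False
      then obtain \<beta> where \<beta>: "\<beta> \<in> ?U" "(E, c) \<in> R \<beta>"
        using Ec(1) T_sub unfolding R0_def by blast
      obtain B where B: "B \<subseteq> ?U" "finite B" "\<U> = C ` B"
        using finite_subset_image[OF \<U>] by blast
      \<comment> \<open>\<open>C \<gamma>\<close> is almost contained in all members of \<open>\<U>\<close> and is faithful to \<open>(E, c)\<close>\<close>
      obtain \<gamma> where \<gamma>: "\<gamma> \<in> insert \<beta> B" "\<forall>\<delta>\<in>insert \<beta> B. (\<delta>, \<gamma>) \<in> continuum"
        using continuum_finite_max[of "insert \<beta> B"] B(2) by blast
      have \<gamma>U: "\<gamma> \<in> ?U" using \<gamma>(1) \<beta>(1) B(1) by blast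
      have "(E, c) \<in> R \<gamma>"
        using mono[OF \<gamma>U] \<gamma>(2) \<beta>(2) by blast
      then have "infinite (E \<inter> C \<gamma>)"
        using faith[OF \<gamma>U] Ec(2) by (simp add: faithful_def)
      moreover have "finite (\<Union>\<delta>\<in>B. C \<gamma> - C \<delta>)"
        using B(2) mono[OF \<gamma>U] \<gamma>(2) by blast
      ultimately have "infinite (E \<inter> C \<gamma> - (\<Union>\<delta>\<in>B. C \<gamma> - C \<delta>))"
        by simp
      then show ?thesis
        by (rule infinite_super[rotated]) (auto simp: B(3))
    qed
    have null: "E = {} \<or> (\<exists>W\<in>C ` ?U. finite (E \<inter> W))" if "(E, {}) \<in> R0" for E
      using that ne faith unfolding R0_def T_def faithful_def by blast
    obtain C' R' where "\<forall>W\<in>C ` ?U. finite (C' - W)" "pairing_algebra X R'" "faithful C' R'" "R0 \<subseteq> R'"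
      "|R'| \<le>o |K \<alpha>|" "\<exists>E. (E, b \<alpha>) \<in> R'" "\<exists>c. (A \<alpha>, c) \<in> R'"
      "inj_on (g \<alpha>) (A \<alpha>) \<longrightarrow> g \<alpha> ` A \<alpha> \<inter> A \<alpha> = {} \<longrightarrow> finite {k \<in> A \<alpha> \<inter> C'. g \<alpha> k \<in> C'}"
      by (rule approximation_step[OF MA ED pair0 small0 b[of \<alpha>] small_image[OF small_underS] pos null K(1) card0,
          where A = "A \<alpha>" and g = "g \<alpha>"])
    then have "\<Phi> f \<alpha> (C', R')"
      by (auto simp: \<Phi>_def R0_def C_def R_def)
    then show "\<exists>x. \<Phi> f \<alpha> x" by blast
  qed
  then obtain f where f: "\<And>\<alpha>. \<Phi> f \<alpha> (f \<alpha>)" by blast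
  have mono: "finite (fst (f \<alpha>) - fst (f \<beta>)) \<and> snd (f \<beta>) \<subseteq> snd (f \<alpha>)" if "(\<beta>, \<alpha>) \<in> continuum" for \<alpha> \<beta>
  proof (cases "\<beta> = \<alpha>")
    case False
    then have "\<beta> \<in> underS continuum \<alpha>" using that by (simp add: underS_def)
    then show ?thesis using f[of \<alpha>] by (simp add: \<Phi>_def)
  qed simp
  show ?thesis
    by (rule exI[of _ "\<lambda>\<alpha>. fst (f \<alpha>)"], rule exI[of _ "\<lambda>\<alpha>. snd (f \<alpha>)"]) (use f mono in \<open>simp add: \<Phi>_def\<close>)
qed

text \<open>
  Every index codes one list of tasks: a set of naturals, a set of naturals standing for a clopen
  set, and a function.
\<close>

lemma continuum_codes:
  "\<exists>code :: (nat \<Rightarrow> bool) \<Rightarrow> nat set \<times> nat set \<times> (nat \<Rightarrow> nat). surj code"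
proof -
  let ?code = "\<lambda>\<alpha>. ({n. \<alpha> (prod_encode (0, n))}, {n. \<alpha> (prod_encode (1, n))},
      \<lambda>n. LEAST m. \<alpha> (prod_encode (2, prod_encode (n, m))))"
  have "\<exists>\<alpha>. x = ?code \<alpha>" for x :: "nat set \<times> nat set \<times> (nat \<Rightarrow> nat)"
  proof -
    obtain A S g where x: "x = (A, S, g)" by (metis prod_cases3)
    let ?a = "\<lambda>k. case prod_decode k of (i, n) \<Rightarrow>
      if i = 0 then n \<in> A else if i = 1 then n \<in> S else (case prod_decode n of (p, m) \<Rightarrow> m = g p)"
    have "(LEAST m. m = j) = j" for j :: nat
      by (rule Least_equality) auto
    then have "x = ?code ?a"
      by (simp add: x)
    then show ?thesis by (rule exI[of _ ?a])
  qed
  then have "surj ?code"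
    unfolding surj_def by (rule allI)
  then show ?thesis by (rule exI[of surj ?code])
qed

text \<open>
  A clopen set is the closure of its trace on a countable dense set.
\<close>

lemma clopens_coded_by_sets:
  assumes "separable_space X"
  obtains b :: "nat set \<Rightarrow> 'a set" where
    "\<And>S. clopenin X (b S)" "\<And>c. clopenin X c \<Longrightarrow> \<exists>S. b S = c"
proof -
  obtain D where D: "countable D" "D \<subseteq> topspace X" "X closure_of D = topspace X"
    using assms unfolding separable_space_def by metis
  define cl where "cl S = X closure_of (from_nat_into D ` S \<inter> D)" for S
  have "\<exists>S. cl S = c" if c: "clopenin X c" for c
  proof
    have "X closure_of (c \<inter> D) = X closure_of c"
      using closure_of_openin_Int_closure_of[of X c D] D(3) c clopenin_subset[OF c]
      by (simp add: clopenin_def Int_absorb2)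
    moreover have "from_nat_into D ` {n. from_nat_into D n \<in> c} \<inter> D = c \<inter> D"
      using from_nat_into_surj[OF D(1)] by auto
    ultimately show "cl {n. from_nat_into D n \<in> c} = c"
      using c by (simp add: cl_def clopenin_def closure_of_closedin)
  qed
  moreover have "clopenin X {}" by (simp add: clopenin_def)
  ultimately show ?thesis
    by (intro that[of "\<lambda>S. if clopenin X (cl S) then cl S else {}"]) (simp, metis)
qed

text \<open>
  The union of the algebras is the graph of \<open>h\<close>.  It is single-valued, because the difference of two
  values of \<open>M\<close> is paired with the empty set and hence empty by faithfulness.
\<close>

lemma quotient_tower_exists:
  fixes X :: "'a topology"
  assumes MA: "Martins_axiom" and sep: "separable_space X" and ED: "extremally_disconnected_space X"
    and ne: "topspace X \<noteq> {}"
  obtains C h where "quotient_tower X C h"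
proof -
  obtain code :: "(nat \<Rightarrow> bool) \<Rightarrow> nat set \<times> nat set \<times> (nat \<Rightarrow> nat)" where code: "surj code"
    using continuum_codes by blast
  obtain b :: "nat set \<Rightarrow> 'a set" where b: "\<And>S. clopenin X (b S)" "\<And>c. clopenin X c \<Longrightarrow> \<exists>S. b S = c"
    using clopens_coded_by_sets[OF sep] by metis
  define A where "A \<alpha> = fst (code \<alpha>)" for \<alpha>
  define c where "c \<alpha> = b (fst (snd (code \<alpha>)))" for \<alpha>
  define g where "g \<alpha> = snd (snd (code \<alpha>))" for \<alpha>
  have "clopenin X (c \<alpha>)" for \<alpha>
    by (simp add: c_def b(1))
  from faithful_tower_exists[OF MA ED ne, of c A g, OF this] obtain C R where
    *: "\<forall>\<alpha>. pairing_algebra X (R \<alpha>) \<and> faithful (C \<alpha>) (R \<alpha>) \<and> (\<exists>E. (E, c \<alpha>) \<in> R \<alpha>) \<and> (\<exists>d. (A \<alpha>, d) \<in> R \<alpha>) \<and>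
      (inj_on (g \<alpha>) (A \<alpha>) \<longrightarrow> g \<alpha> ` A \<alpha> \<inter> A \<alpha> = {} \<longrightarrow> finite {k \<in> A \<alpha> \<inter> C \<alpha>. g \<alpha> k \<in> C \<alpha>})"
    "\<forall>\<alpha> \<beta>. (\<beta>, \<alpha>) \<in> continuum \<longrightarrow> finite (C \<alpha> - C \<beta>) \<and> R \<beta> \<subseteq> R \<alpha>"
    by blast
  have CR: "pairing_algebra X (R \<alpha>)" "faithful (C \<alpha>) (R \<alpha>)"
    "(\<beta>, \<alpha>) \<in> continuum \<Longrightarrow> finite (C \<alpha> - C \<beta>)" "(\<beta>, \<alpha>) \<in> continuum \<Longrightarrow> R \<beta> \<subseteq> R \<alpha>"
    "\<exists>E. (E, c \<alpha>) \<in> R \<alpha>" "\<exists>d. (A \<alpha>, d) \<in> R \<alpha>"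
    "inj_on (g \<alpha>) (A \<alpha>) \<Longrightarrow> g \<alpha> ` A \<alpha> \<inter> A \<alpha> = {} \<Longrightarrow> finite {k \<in> A \<alpha> \<inter> C \<alpha>. g \<alpha> k \<in> C \<alpha>}"
    for \<alpha> \<beta>
    using * by simp_all
  have codeE: "\<exists>\<alpha>. code \<alpha> = (M, S, g)" for M S g
    using code by (metis surjD)
  define Q where "Q = (\<Union>\<alpha>. R \<alpha>)"
  have Q: "pairing_algebra X Q"
    unfolding Q_def
  proof (rule pairing_Union_chain)
    fix S S' assume "S \<in> range R" "S' \<in> range R"
    then obtain \<alpha> \<beta> where "S = R \<alpha>" "S' = R \<beta>" by blast
    then show "S \<subseteq> S' \<or> S' \<subseteq> S"
      using CR(4) continuum_linear by metis
  qed (use CR(1) in auto)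
  have Q_unique: "b = b'" if "(M, b) \<in> Q" "(M, b') \<in> Q" for M b b'
  proof -
    have "b - b' = {}" if bb': "(M, b) \<in> Q" "(M, b') \<in> Q" for b b'
    proof -
      have "({}, b - b') \<in> Q"
        using pairing_Diff[OF Q bb'] by simp
      then show ?thesis
        using CR(2) by (auto simp: Q_def faithful_def)
    qed
    then show ?thesis using that by blast
  qed
  define h where "h M = (THE c. (M, c) \<in> Q)" for M
  have hQ: "(M, h M) \<in> Q" for M
  proof -
    obtain \<alpha> where "code \<alpha> = (M, {}, id)" using codeE by blast
    then obtain c where "(M, c) \<in> Q"
      using CR(6)[of \<alpha>] by (auto simp: Q_def A_def)
    then show ?thesis
      unfolding h_def using Q_unique by (metis theI)
  qed
  have h_eq: "h M = c" if "(M, c) \<in> Q" for M c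
    using hQ that Q_unique by blast
  show ?thesis
  proof (rule that[of C h], unfold_locales)
    fix M
    show "clopenin X (h M)" by (rule pairing_clopenin[OF Q hQ])
    show "h (- M) = topspace X - h M" by (rule h_eq[OF pairing_Compl[OF Q hQ]])
    show "h (M \<inter> N) = h M \<inter> h N" for N
      by (rule h_eq[OF pairing_Int[OF Q hQ hQ]])
    obtain \<alpha> where \<alpha>: "(M, h M) \<in> R \<alpha>"
      using hQ by (auto simp: Q_def)
    show "h M = {} \<longleftrightarrow> (\<exists>\<alpha>. finite (M \<inter> C \<alpha>))"
    proof
      assume "h M = {}"
      then show "\<exists>\<alpha>. finite (M \<inter> C \<alpha>)"
        using \<alpha> CR(2) unfolding faithful_def by blast
    next
      assume "\<exists>\<alpha>. finite (M \<inter> C \<alpha>)"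
      then obtain \<beta> where \<beta>: "finite (M \<inter> C \<beta>)" ..
      obtain \<gamma> where \<gamma>: "(\<alpha>, \<gamma>) \<in> continuum" "(\<beta>, \<gamma>) \<in> continuum"
        using continuum_linear continuum_refl by blast
      have "finite ((M \<inter> C \<beta>) \<union> (C \<gamma> - C \<beta>))"
        using \<beta> CR(3)[OF \<gamma>(2)] by simp
      then have "finite (M \<inter> C \<gamma>)"
        by (rule finite_subset[rotated]) auto
      moreover have "(M, h M) \<in> R \<gamma>"
        using \<alpha> CR(4)[OF \<gamma>(1)] by blast
      ultimately show "h M = {}"
        using CR(2)[of \<gamma>] unfolding faithful_def by blast
    qed
  next
    fix d assume "clopenin X d"
    then obtain S where S: "b S = d" using b(2) by blast
    obtain \<alpha> where "code \<alpha> = ({}, S, id)" using codeE by blast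
    then obtain E where "(E, d) \<in> Q"
      using CR(5)[of \<alpha>] S by (auto simp: Q_def c_def)
    then show "\<exists>M. h M = d" using h_eq by blast
  next
    fix f :: "nat \<Rightarrow> nat" and M assume gM: "inj_on f M" "f ` M \<inter> M = {}"
    obtain \<alpha> where "code \<alpha> = (M, {}, f)" using codeE by blast
    then show "\<exists>\<alpha>. finite {k \<in> M \<inter> C \<alpha>. f k \<in> C \<alpha>}"
      using CR(7)[of \<alpha>] gM by (auto simp: A_def g_def)
  qed (use CR(3) ne in auto)
qed

section \<open>The space of ultrafilters\<close>

text \<open>
  The basic clopen subset of \<open>\<beta>\<omega>\<close> given by \<open>A\<close>.
\<close>

definition stone :: "nat set \<Rightarrow> nat filter set"
  where "stone A = {p. ultrafilter p \<and> (\<forall>\<^sub>F n in p. n \<in> A)}"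

lemma beta_omega_eq: "beta_omega = topology_generated_by (range stone)"
  by (simp add: beta_omega_def stone_def[abs_def])

lemma stone_Int: "stone A \<inter> stone B = stone (A \<inter> B)"
  by (auto simp: stone_def eventually_conj_iff)

lemma stone_UNIV: "stone UNIV = Collect ultrafilter"
  by (simp add: stone_def)

lemma topspace_beta_omega: "topspace beta_omega = Collect ultrafilter"
  unfolding beta_omega_eq topology_generated_by_topspace
  by (auto simp: stone_def intro!: exI[of _ UNIV])

lemma openin_stone: "openin beta_omega (stone A)"
  unfolding beta_omega_eq by (rule topology_generated_by_Basis) simp

lemma stone_base:
  assumes "openin beta_omega U" "p \<in> U"
  shows "\<exists>A. p \<in> stone A \<and> stone A \<subseteq> U"
proof -
  have "generate_topology_on (range stone) U"
    using assms(1) unfolding beta_omega_eq by (rule openin_topology_generated_by)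
  then have "\<forall>p\<in>U. \<exists>A. p \<in> stone A \<and> stone A \<subseteq> U"
  proof induction
    case (Int a b)
    show ?case
    proof
      fix p assume "p \<in> a \<inter> b"
      then obtain A B where "p \<in> stone A" "stone A \<subseteq> a" "p \<in> stone B" "stone B \<subseteq> b"
        using Int.IH by blast
      then have "p \<in> stone (A \<inter> B)" "stone (A \<inter> B) \<subseteq> a \<inter> b"
        by (auto simp flip: stone_Int)
      then show "\<exists>A. p \<in> stone A \<and> stone A \<subseteq> a \<inter> b" by blast
    qed
  next
    case (UN K)
    then show ?case by (meson Union_iff Union_upper order_trans)
  qed auto
  then show ?thesis using assms(2) by blast
qed

lemma ultrafilter_cases: "ultrafilter p \<Longrightarrow> (\<forall>\<^sub>F n in p. P n) \<or> (\<forall>\<^sub>F n in p. \<not> P n)"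
  unfolding ultrafilter_def by (drule conjunct2, drule spec[of _ "Collect P"]) simp

lemma ultrafilter_not:
  assumes "ultrafilter p"
  shows "(\<forall>\<^sub>F n in p. \<not> P n) \<longleftrightarrow> \<not> (\<forall>\<^sub>F n in p. P n)"
proof
  assume "\<forall>\<^sub>F n in p. \<not> P n"
  show "\<not> (\<forall>\<^sub>F n in p. P n)"
  proof
    assume "\<forall>\<^sub>F n in p. P n"
    with \<open>\<forall>\<^sub>F n in p. \<not> P n\<close> have "\<forall>\<^sub>F n in p. False"
      by eventually_elim simp
    then show False
      using assms by (simp add: ultrafilter_def trivial_limit_def)
  qed
qed (use ultrafilter_cases[OF assms] in blast)

lemma stone_Compl: "stone (- A) = Collect ultrafilter - stone A"
  by (auto simp: stone_def ultrafilter_not)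

lemma Hausdorff_beta_omega: "Hausdorff_space beta_omega"
  unfolding Hausdorff_space_def topspace_beta_omega
proof (intro allI impI, elim conjE)
  fix p q :: "nat filter" assume "p \<in> Collect ultrafilter" "q \<in> Collect ultrafilter" "p \<noteq> q"
  then obtain P where P: "eventually P p \<noteq> eventually P q"
    by (auto simp: filter_eq_iff)
  have disj: "disjnt (stone (Collect P)) (stone (- Collect P))" "disjnt (stone (- Collect P)) (stone (Collect P))"
    by (auto simp: stone_Compl disjnt_def)
  have "p \<in> stone (Collect P) \<and> q \<in> stone (- Collect P) \<or> p \<in> stone (- Collect P) \<and> q \<in> stone (Collect P)"
    using P \<open>p \<in> _\<close> \<open>q \<in> _\<close> by (auto simp: stone_def ultrafilter_not)
  then show "\<exists>U V. openin beta_omega U \<and> openin beta_omega V \<and> p \<in> U \<and> q \<in> V \<and> disjnt U V"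
    using openin_stone disj by metis
qed

text \<open>
  Ultrafilters are prime.
\<close>

lemma ultrafilter_finite_Union:
  assumes p: "ultrafilter p" and "finite \<A>" "\<forall>\<^sub>F n in p. n \<in> \<Union>\<A>"
  shows "\<exists>A\<in>\<A>. \<forall>\<^sub>F n in p. n \<in> A"
proof (rule ccontr)
  assume "\<not> ?thesis"
  then have "\<forall>A\<in>\<A>. \<forall>\<^sub>F n in p. n \<notin> A"
    by (simp add: ultrafilter_not[OF p])
  then have "\<forall>\<^sub>F n in p. \<forall>A\<in>\<A>. n \<notin> A"
    using assms(2) by (simp add: eventually_ball_finite)
  then have "\<forall>\<^sub>F n in p. \<not> n \<in> \<Union>\<A>"
    by (rule eventually_mono) auto
  then show False
    using assms(3) ultrafilter_not[OF p] by blast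
qed

text \<open>
  An ultrafilter that lacks some cofinite set contains a finite set, hence a singleton, and is
  principal.
\<close>

lemma topspace_omega_star:
  "topspace omega_star = {p. ultrafilter p \<and> p \<le> cofinite}"
proof -
  have "p \<le> cofinite \<longleftrightarrow> p \<notin> range (\<lambda>n. principal {n})" if p: "ultrafilter p" for p :: "nat filter"
  proof
    assume le: "p \<le> cofinite"
    show "p \<notin> range (\<lambda>n. principal {n})"
    proof
      assume "p \<in> range (\<lambda>n. principal {n})"
      then obtain n where n: "p = principal {n}" by blast
      have "eventually (\<lambda>k. k \<noteq> n) cofinite" by (simp add: eventually_cofinite)
      then have "eventually (\<lambda>k. k \<noteq> n) p" using le by (simp add: le_filter_def)
      then show False by (simp add: n eventually_principal)
    qed
  next
    assume np: "p \<notin> range (\<lambda>n. principal {n})"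
    show "p \<le> cofinite"
    proof (rule filter_leI, rule ccontr)
      fix P assume "eventually P cofinite" "\<not> eventually P p"
      then have "finite {n. \<not> P n}" "\<forall>\<^sub>F n in p. \<not> P n"
        by (simp_all add: eventually_cofinite ultrafilter_not[OF p])
      then have "finite ((\<lambda>n. {n}) ` {n. \<not> P n})" "\<forall>\<^sub>F n in p. n \<in> \<Union>((\<lambda>n. {n}) ` {n. \<not> P n})"
        by simp_all
      from ultrafilter_finite_Union[OF p this] obtain k where k: "\<forall>\<^sub>F n in p. n = k"
        by auto
      have "p = principal {k}"
        unfolding filter_eq_iff eventually_principal
      proof
        fix Q
        have "eventually Q p" if "Q k"
          using k by (rule eventually_mono) (simp add: that)
        moreover have "\<not> eventually Q p" if "\<not> Q k"
          unfolding ultrafilter_not[OF p, symmetric] using k by (rule eventually_mono) (simp add: that)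
        ultimately show "eventually Q p \<longleftrightarrow> (\<forall>x\<in>{k}. Q x)" by auto
      qed
      then show False using np by blast
    qed
  qed
  then show ?thesis
    by (auto simp: omega_star_def topspace_beta_omega)
qed

lemma openin_omega_star_stone: "openin omega_star (stone A \<inter> topspace omega_star)"
  unfolding omega_star_def topspace_subtopology openin_subtopology
  using openin_stone openin_subset by (intro exI[of _ "stone A"]) blast

lemma omega_star_base:
  assumes "openin omega_star U" "p \<in> U"
  shows "\<exists>A. p \<in> stone A \<and> stone A \<inter> topspace omega_star \<subseteq> U"
proof -
  obtain V where V: "openin beta_omega V" "U = V \<inter> - range (\<lambda>n. principal {n})"
    using assms(1) by (auto simp: omega_star_def openin_subtopology)
  obtain A where A: "p \<in> stone A" "stone A \<subseteq> V"
    using stone_base[OF V(1)] assms(2) V(2) by blast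
  then show ?thesis
    unfolding V(2) omega_star_def topspace_subtopology by blast
qed

lemma K_set_subset: "F \<le> cofinite \<Longrightarrow> K_set F \<subseteq> topspace omega_star"
  by (auto simp: K_set_def topspace_omega_star)

lemma closedin_K_set:
  assumes "F \<le> cofinite"
  shows "closedin omega_star (K_set F)"
  unfolding closedin_def
proof
  show "openin omega_star (topspace omega_star - K_set F)"
  proof (subst openin_subopen, rule ballI)
    fix p assume p: "p \<in> topspace omega_star - K_set F"
    then have up: "ultrafilter p" by (simp add: topspace_omega_star)
    with p obtain P where P: "eventually P F" "\<not> eventually P p"
      by (auto simp: K_set_def le_filter_def)
    let ?T = "stone (- Collect P) \<inter> topspace omega_star"
    have "p \<in> ?T"
      using p up P(2) by (simp add: stone_def ultrafilter_not)
    moreover have "?T \<subseteq> topspace omega_star - K_set F"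
      using P(1) by (auto simp: stone_def K_set_def le_filter_def ultrafilter_not)
    ultimately show "\<exists>T. openin omega_star T \<and> p \<in> T \<and> T \<subseteq> topspace omega_star - K_set F"
      using openin_omega_star_stone by blast
  qed
qed (rule K_set_subset[OF assms])

section \<open>Reversible filters and towers\<close>

text \<open>
  Colour the numbers one after the other.  When \<open>n\<close> is coloured, at most two colours are excluded:
  that of \<open>g n\<close> and that of the preimage of \<open>n\<close>, as far as these are smaller than \<open>n\<close>.
\<close>

lemma three_colouring:
  fixes g :: "nat \<Rightarrow> nat"
  assumes "inj g"
  shows "\<exists>c. \<forall>n. c n < (3 :: nat) \<and> (g n \<noteq> n \<longrightarrow> c (g n) \<noteq> c n)"
proof -
  let ?ok = "\<lambda>c n r. r < (3 :: nat) \<and> (g n < n \<longrightarrow> r \<noteq> c (g n)) \<and> (\<forall>k<n. g k = n \<longrightarrow> r \<noteq> c k)"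
  have "\<exists>c. \<forall>n. ?ok c n (c n)"
  proof (rule dependent_wf_choice[OF wf_less])
    fix n and c :: "nat \<Rightarrow> nat"
    have "\<exists>b. \<forall>k<n. g k = n \<longrightarrow> c k = b"
      using assms by (metis injD)
    then obtain b where b: "\<forall>k<n. g k = n \<longrightarrow> c k = b" ..
    have "\<exists>r<3. r \<noteq> c (g n) \<and> r \<noteq> b" by presburger
    then show "\<exists>r. ?ok c n r" using b by metis
  qed auto
  then obtain c where c: "\<And>n. ?ok c n (c n)" by blast
  have "c (g n) \<noteq> c n" if "g n \<noteq> n" for n
    using c[of n] c[of "g n"] that by (metis linorder_neqE_nat)
  then show ?thesis using c by blast
qed

text \<open>
  A continuous bijection of \<open>\<xi>(F)\<close> fixes the point \<open>F\<close>, unless the space is discrete, and permutes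
  \<open>\<omega>\<close> by some \<open>g\<close> such that \<open>g n \<in> A\<close> holds \<open>F\<close>-almost surely for every member \<open>A\<close> of \<open>F\<close>.  If \<open>A\<close>
  displaces a colour class \<open>M\<close> of moved points, then \<open>F\<close>-almost no point lies in \<open>M\<close>, because almost
  all points and their images lie in \<open>A\<close>.  So almost all points are fixed by \<open>g\<close>, and the bijection
  is open at \<open>F\<close>.
\<close>

lemma reversible_filterI:
  assumes cof: "F \<le> cofinite"
    and displace: "\<And>g M. inj_on g M \<Longrightarrow> g ` M \<inter> M = {} \<Longrightarrow>
      \<exists>A. (\<forall>\<^sub>F n in F. n \<in> A) \<and> finite {k \<in> M \<inter> A. g k \<in> A}"
  shows "reversible_filter F"
  unfolding reversible_filter_def reversible_space_def
proof (intro allI impI, elim conjE)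
  fix f assume cont: "continuous_map (xi F) (xi F) f"
    and bij: "bij_betw f (topspace (xi F)) (topspace (xi F))"
  have top: "topspace (xi F) = UNIV"
    using openin_subset[of "xi F" UNIV] by (simp add: openin_xi top.extremum_unique)
  have f: "bij f" using bij by (simp add: top)
  have pre: "openin (xi F) (f -` U)" if "openin (xi F) U" for U
    using cont that by (simp add: continuous_map_alt top)
  have "open_map (xi F) (xi F) f"
  proof (cases "F = bot")
    case True
    then show ?thesis by (simp add: open_map_def openin_xi)
  next
    case False
    have fN: "f None = None"
    proof (rule ccontr)
      assume "f None \<noteq> None"
      then obtain n where n: "f None = Some n" by blast
      have "f -` {Some n} = {None}"
      proof
        show "f -` {Some n} \<subseteq> {None}"
          using n injD[of f _ None] f by (auto simp: bij_def)
      qed (simp add: n)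
      moreover have "openin (xi F) (f -` {Some n})"
        by (rule pre) (simp add: openin_xi)
      ultimately show False
        using False by (simp add: openin_xi trivial_limit_def)
    qed
    define g where "g n = the (f (Some n))" for n
    have g: "f (Some n) = Some (g n)" for n
    proof -
      have "f (Some n) \<noteq> None"
        using f fN by (metis bij_def injD option.distinct(1))
      then show ?thesis by (simp add: g_def)
    qed
    have "inj g"
      using f g by (metis bij_def injD injI option.inject)
    have ev: "\<forall>\<^sub>F n in F. g n \<in> A" if "\<forall>\<^sub>F n in F. n \<in> A" for A
    proof -
      have "openin (xi F) (insert None (Some ` A))"
        using that by (auto simp: openin_xi elim: eventually_mono)
      from pre[OF this] have "\<forall>\<^sub>F n in F. Some n \<in> f -` (insert None (Some ` A))"
        by (simp add: openin_xi fN)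
      then show ?thesis
        by (rule eventually_mono) (auto simp: g)
    qed
    obtain c where c: "\<And>n. c n < (3 :: nat)" "\<And>n. g n \<noteq> n \<Longrightarrow> c (g n) \<noteq> c n"
      using three_colouring[OF \<open>inj g\<close>] by blast
    have colour: "\<forall>\<^sub>F n in F. \<not> (g n \<noteq> n \<and> c n = i)" for i
    proof -
      define M where "M = {n. g n \<noteq> n \<and> c n = i}"
      have "inj_on g M"
        using \<open>inj g\<close> by (rule inj_on_subset) simp
      moreover have "g k \<notin> M" if "k \<in> M" for k
        using c(2)[of k] that by (auto simp: M_def)
      then have "g ` M \<inter> M = {}" by blast
      ultimately obtain A where A: "\<forall>\<^sub>F n in F. n \<in> A" "finite {k \<in> M \<inter> A. g k \<in> A}"
        using displace by blast
      have "\<forall>\<^sub>F n in cofinite. n \<notin> {k \<in> M \<inter> A. g k \<in> A}"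
        unfolding eventually_cofinite not_not Collect_mem_eq by (rule A(2))
      then have "\<forall>\<^sub>F n in F. n \<notin> {k \<in> M \<inter> A. g k \<in> A}"
        using cof by (simp add: le_filter_def)
      with A(1) ev[OF A(1)] show ?thesis
        by eventually_elim (auto simp: M_def)
    qed
    have "\<forall>\<^sub>F n in F. \<forall>i\<in>{..<3}. \<not> (g n \<noteq> n \<and> c n = i)"
      by (rule eventually_ball_finite[OF finite_lessThan]) (rule ballI, rule colour)
    then have fixed: "\<forall>\<^sub>F n in F. g n = n"
      by (rule eventually_mono) (use c(1) in auto)
    show ?thesis
      unfolding open_map_def
    proof (intro allI impI)
      fix U assume U: "openin (xi F) U"
      show "openin (xi F) (f ` U)"
        unfolding openin_xi
      proof
        assume "None \<in> f ` U"
        then have "None \<in> U"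
          using f fN by (metis bij_def imageE injD)
        then have "\<forall>\<^sub>F n in F. Some n \<in> U" using U by (simp add: openin_xi)
        then show "\<forall>\<^sub>F n in F. Some n \<in> f ` U"
          using fixed by eventually_elim (metis g image_eqI)
      qed
    qed
  qed
  then show "homeomorphic_map (xi F) (xi F) f"
    using cont f by (intro bijective_open_imp_homeomorphic_map) (simp_all add: top bij_def)
qed

text \<open>
  The sets \<open>C \<alpha>\<close> decrease only up to finite sets, so directedness of the generating filters holds
  after intersecting each of them with the cofinite filter.
\<close>

lemma eventually_tower_filter:
  assumes decr: "\<And>\<alpha> \<beta>. (\<beta>, \<alpha>) \<in> continuum \<Longrightarrow> finite (C \<alpha> - C \<beta>)"
  shows "eventually P (tower_filter continuum C) \<longleftrightarrow> (\<exists>\<alpha>. finite (C \<alpha> - Collect P))"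
proof -
  let ?G = "\<lambda>\<alpha>. inf cofinite (principal (C \<alpha>))"
  have ev: "eventually Q (?G \<alpha>) \<longleftrightarrow> finite (C \<alpha> - Collect Q)" for Q \<alpha>
  proof -
    have "{n. \<not> (n \<in> C \<alpha> \<longrightarrow> Q n)} = C \<alpha> - Collect Q" by auto
    then show ?thesis by (simp add: eventually_inf_principal eventually_cofinite)
  qed
  have mono: "?G \<alpha> \<le> ?G \<beta>" if "(\<beta>, \<alpha>) \<in> continuum" for \<alpha> \<beta>
  proof (rule filter_leI)
    fix Q assume "eventually Q (?G \<beta>)"
    then have "finite ((C \<beta> - Collect Q) \<union> (C \<alpha> - C \<beta>))"
      using decr[OF that] by (simp add: ev)
    then show "eventually Q (?G \<alpha>)"
      unfolding ev by (rule finite_subset[rotated]) auto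
  qed
  have "tower_filter continuum C = (INF \<alpha>. ?G \<alpha>)"
    by (simp add: tower_filter_def Field_continuum INF_inf_const1)
  moreover have "eventually P (INF \<alpha>. ?G \<alpha>) \<longleftrightarrow> (\<exists>\<alpha>\<in>UNIV. eventually P (?G \<alpha>))"
  proof (rule eventually_INF_base)
    fix \<alpha> \<beta>
    show "\<exists>\<gamma>\<in>UNIV. ?G \<gamma> \<le> inf (?G \<alpha>) (?G \<beta>)"
      using continuum_linear[of \<alpha> \<beta>] mono[of \<alpha> \<beta>] mono[of \<beta> \<alpha>] by (metis UNIV_I le_inf_iff order_refl)
  qed simp
  ultimately show ?thesis by (simp add: ev)
qed

text \<open>
  Enumerate \<open>B\<close>; take the points with even index for \<open>M\<close> and move each to its successor.
\<close>

lemma infinite_shift: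
  fixes B :: "nat set"
  assumes "infinite B"
  obtains M g where "infinite M" "M \<subseteq> B" "inj_on g M" "g ` M \<subseteq> B" "g ` M \<inter> M = {}"
proof -
  obtain e where e: "inj e" and eB: "\<And>j :: nat. e j \<in> B"
    using bij_enumerate[OF assms] enumerate_in_set[OF assms] by (auto simp: bij_betw_def)
  define M where "M = e ` {j. even j}"
  define g where "g k = e (Suc (inv e k))" for k
  have g: "g (e j) = e (Suc j)" for j
    by (simp add: g_def inv_f_f[OF e])
  have "infinite {j :: nat. even j}"
    unfolding infinite_nat_iff_unbounded by (metis even_Suc lessI less_Suc_eq mem_Collect_eq)
  then have "infinite M"
    unfolding M_def using e by (simp add: finite_image_iff inj_on_subset)
  moreover have "inj_on g M"
    using e by (auto simp: M_def g inj_on_def)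
  moreover have "g k \<notin> M" if kM: "k \<in> M" for k
  proof
    assume "g k \<in> M"
    then obtain i j where ij: "even i" "k = e i" "even j" "g k = e j"
      using kM unfolding M_def image_iff by blast
    then have "e (Suc i) = e j" by (simp add: g)
    then show False
      using injD[OF e] ij(1,3) by fastforce
  qed
  then have "g ` M \<inter> M = {}" by blast
  moreover have "M \<subseteq> B"
    unfolding M_def by (rule image_subsetI) (rule eB)
  moreover have "g ` M \<subseteq> B"
  proof (rule image_subsetI)
    fix k assume "k \<in> M"
    then obtain j where "k = e j" unfolding M_def by (rule imageE)
    then show "g k \<in> B" using eB[of "Suc j"] by (simp only: g)
  qed
  ultimately show ?thesis using that by blast
qed

text \<open>
  The empty space is the only one whose filter is improper; a constant tower generates it.
\<close>

lemma bot_is_tower_filter: "tower continuum (\<lambda>_. {})" "tower_filter continuum (\<lambda>_. {}) = bot"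
proof -
  show "tower continuum (\<lambda>_. {})"
    by (auto simp: tower_def Field_continuum)
  show "tower_filter continuum (\<lambda>_. {}) = bot"
    by (auto simp: filter_eq_iff eventually_tower_filter)
qed

section \<open>The filter of a quotient tower\<close>

context quotient_tower
begin

abbreviation F :: "nat filter"
  where "F \<equiv> tower_filter continuum C"

lemma h_open: "openin X (h M)"
  using h_clopen by (simp add: clopenin_def)

lemma h_empty [simp]: "h {} = {}"
  by (simp add: h_null)

lemma h_UNIV [simp]: "h UNIV = topspace X"
  using h_Compl[of "{}"] by simp

lemma h_subset: "h M \<subseteq> topspace X"
  by (rule openin_subset[OF h_open])

lemma h_mono: "M \<subseteq> N \<Longrightarrow> h M \<subseteq> h N"
  using h_Int[of M N] by (metis Int_absorb2 Int_lower2)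

lemma eventually_F: "eventually P F \<longleftrightarrow> (\<exists>\<alpha>. finite (C \<alpha> - Collect P))"
  by (rule eventually_tower_filter[OF decreasing])

lemma eventually_F_iff_h: "eventually P F \<longleftrightarrow> h (Collect P) = topspace X"
proof -
  have "eventually P F \<longleftrightarrow> h (- Collect P) = {}"
    by (simp add: eventually_F h_null Int_commute Diff_eq)
  then show ?thesis
    using h_subset[of "Collect P"] by (auto simp: h_Compl)
qed

lemma eventually_C: "\<forall>\<^sub>F n in F. n \<in> C \<alpha>"
  by (auto simp: eventually_F intro!: exI[of _ \<alpha>])

lemma F_le_cofinite: "F \<le> cofinite"
  by (simp add: tower_filter_def)

lemma infinite_C: "infinite (C \<alpha>)"
  using h_null[of UNIV] nonempty by auto

text \<open>
  Displacement is applied to a map \<open>g\<close> of one half \<open>M\<close> of \<open>B\<close> into the other.  For some \<open>\<alpha>\<close>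
  only finitely many \<open>k \<in> M\<close> have both \<open>k\<close> and \<open>g k\<close> in \<open>C \<alpha>\<close>, but almost all points of \<open>B\<close> lie in \<open>C \<alpha>\<close>.
\<close>

lemma no_pseudointersection:
  assumes "infinite B" "\<And>\<alpha>. finite (B - C \<alpha>)"
  shows False
proof -
  obtain M g where M: "infinite M" "M \<subseteq> B" "inj_on g M" "g ` M \<subseteq> B" "g ` M \<inter> M = {}"
    using infinite_shift[OF assms(1)] .
  obtain \<alpha> where \<alpha>: "finite {k \<in> M \<inter> C \<alpha>. g k \<in> C \<alpha>}"
    using displacing[OF M(3,5)] by blast
  have "finite (g -` (B - C \<alpha>) \<inter> M)"
    by (rule finite_vimage_IntI[OF assms(2) M(3)])
  then have "finite ({k \<in> M \<inter> C \<alpha>. g k \<in> C \<alpha>} \<union> (B - C \<alpha>) \<union> (g -` (B - C \<alpha>) \<inter> M))"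
    using \<alpha> assms(2) by simp
  moreover have "M \<subseteq> {k \<in> M \<inter> C \<alpha>. g k \<in> C \<alpha>} \<union> (B - C \<alpha>) \<union> (g -` (B - C \<alpha>) \<inter> M)"
    using M(2,4) by auto
  ultimately show False
    using M(1) finite_subset by blast
qed

lemma tower_C: "tower continuum C"
  unfolding tower_def
proof (intro conjI notI)
  show "\<forall>\<alpha> \<beta>. (\<alpha>, \<beta>) \<in> continuum \<and> \<alpha> \<noteq> \<beta> \<longrightarrow> finite (C \<beta> - C \<alpha>)"
    using decreasing by blast
  assume "\<exists>B. infinite B \<and> (\<forall>\<alpha>\<in>Field continuum. finite (B - C \<alpha>))"
  then show False
    using no_pseudointersection by (auto simp: Field_continuum)
qed

text \<open>
  Martin's axiom gives the countable family an infinite pseudointersection.  If the family were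
  cofinal in the tower, it would be a pseudointersection of the whole tower.
\<close>

lemma countable_bound:
  assumes MA: "Martins_axiom"
  shows "\<exists>\<alpha>. \<forall>n. finite (C \<alpha> - C (f (n :: nat)))"
proof (rule ccontr)
  assume unbounded: "\<nexists>\<alpha>. \<forall>n. finite (C \<alpha> - C (f n))"
  have "small (range (\<lambda>n. C (f n)))" "small {UNIV :: nat set}"
    by (intro small_countable; simp)+
  moreover have "infinite (P \<inter> \<Inter>\<U>)"
    if \<U>: "finite \<U>" "\<U> \<subseteq> range (\<lambda>n. C (f n))" and P: "P \<in> {UNIV}" for \<U> P
  proof -
    obtain N where N: "finite N" "\<U> = (\<lambda>n. C (f n)) ` N"
      using finite_subset_image[OF \<U>] by metis
    \<comment> \<open>the extra index only keeps the set nonempty when \<open>\<U>\<close> is empty\<close>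
    obtain \<gamma> where \<gamma>: "\<forall>\<beta>\<in>f ` N. (\<beta>, \<gamma>) \<in> continuum"
      using continuum_finite_max[of "insert undefined (f ` N)"] N(1) by auto
    have "finite (\<Union>n\<in>N. C \<gamma> - C (f n))"
      using N(1) decreasing \<gamma> by blast
    then have "infinite (C \<gamma> - (\<Union>n\<in>N. C \<gamma> - C (f n)))"
      using infinite_C by simp
    then show ?thesis
      by (rule infinite_super[rotated]) (use P in \<open>auto simp: N(2)\<close>)
  qed
  ultimately obtain D where D: "\<And>W. W \<in> range (\<lambda>n. C (f n)) \<Longrightarrow> finite (D - W)"
    "\<And>P. P \<in> {UNIV} \<Longrightarrow> infinite (P \<inter> D)"
    using MA_pseudointersection[OF MA, of "range (\<lambda>n. C (f n))" "{UNIV}"] by metis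
  have "finite (D - C \<alpha>)" for \<alpha>
  proof -
    obtain n where "\<not> finite (C \<alpha> - C (f n))"
      using unbounded by blast
    then have "finite (C (f n) - C \<alpha>)"
      using decreasing continuum_linear by blast
    then have "finite ((D - C (f n)) \<union> (C (f n) - C \<alpha>))"
      using D(1) by blast
    then show ?thesis
      by (rule finite_subset[rotated]) blast
  qed
  moreover have "infinite D"
    using D(2)[of UNIV] by simp
  ultimately show False
    using no_pseudointersection by blast
qed

lemma reversible_F: "reversible_filter F"
proof (rule reversible_filterI[OF F_le_cofinite])
  fix g :: "nat \<Rightarrow> nat" and M assume "inj_on g M" "g ` M \<inter> M = {}"
  then obtain \<alpha> where "finite {k \<in> M \<inter> C \<alpha>. g k \<in> C \<alpha>}"
    using displacing by blast
  then show "\<exists>A. (\<forall>\<^sub>F n in F. n \<in> A) \<and> finite {k \<in> M \<inter> A. g k \<in> A}"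
    using eventually_C by blast
qed

text \<open>
  The Stone dual of \<open>h\<close>, as a map from \<open>X\<close> into the space of ultrafilters.
\<close>

definition point_filter :: "'a \<Rightarrow> nat filter"
  where "point_filter x = Abs_filter (\<lambda>P. x \<in> h (Collect P))"

lemma eventually_point_filter:
  assumes "x \<in> topspace X"
  shows "eventually P (point_filter x) \<longleftrightarrow> x \<in> h (Collect P)"
  unfolding point_filter_def
proof (rule eventually_Abs_filter)
  show "is_filter (\<lambda>P. x \<in> h (Collect P))"
  proof
    show "x \<in> h {n. True}" using assms by simp
    show "x \<in> h {n. P n \<and> Q n}" if "x \<in> h (Collect P)" "x \<in> h (Collect Q)" for P Q
      using that by (simp add: Collect_conj_eq h_Int)
    show "x \<in> h (Collect Q)" if "\<forall>n. P n \<longrightarrow> Q n" "x \<in> h (Collect P)" for P Q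
      using h_mono[of "Collect P" "Collect Q"] that by blast
  qed
qed

lemma point_filter_in_stone:
  assumes "x \<in> topspace X"
  shows "point_filter x \<in> stone A \<longleftrightarrow> x \<in> h A"
proof -
  have "ultrafilter (point_filter x)"
    unfolding ultrafilter_def
  proof
    show "point_filter x \<noteq> bot"
      by (simp add: trivial_limit_def eventually_point_filter[OF assms])
    show "\<forall>A. (\<forall>\<^sub>F n in point_filter x. n \<in> A) \<or> (\<forall>\<^sub>F n in point_filter x. n \<notin> A)"
    proof
      fix A :: "nat set"
      have "Collect (\<lambda>n. n \<notin> A) = - A" by auto
      then show "(\<forall>\<^sub>F n in point_filter x. n \<in> A) \<or> (\<forall>\<^sub>F n in point_filter x. n \<notin> A)"
        using assms by (simp add: eventually_point_filter[OF assms] h_Compl)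
    qed
  qed
  then show ?thesis
    by (simp add: stone_def eventually_point_filter[OF assms])
qed

lemma point_filter_in_K:
  assumes "x \<in> topspace X"
  shows "point_filter x \<in> K_set F"
proof -
  have "ultrafilter (point_filter x)"
    using point_filter_in_stone[OF assms, of UNIV] assms by (simp add: stone_UNIV)
  moreover have "point_filter x \<le> F"
    using assms by (intro filter_leI) (simp add: eventually_F_iff_h eventually_point_filter[OF assms])
  ultimately show ?thesis by (simp add: K_set_def)
qed

text \<open>
  For \<open>p \<in> K_set F\<close> the clopen sets \<open>h A\<close> with \<open>A\<close> in \<open>p\<close> are nonempty, since otherwise the complement of
  \<open>A\<close> would belong to \<open>F\<close> and so to \<open>p\<close>.  By compactness they have a common point \<open>x\<close>, and
  \<open>p = point_filter x\<close> by maximality.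
\<close>

lemma K_eq_image:
  assumes "compact_space X"
  shows "K_set F = point_filter ` topspace X"
proof
  show "point_filter ` topspace X \<subseteq> K_set F"
    using point_filter_in_K by blast
  show "K_set F \<subseteq> point_filter ` topspace X"
  proof
    fix p assume "p \<in> K_set F"
    then have p: "ultrafilter p" "p \<le> F" by (simp_all add: K_set_def)
    let ?\<C> = "h ` {A. \<forall>\<^sub>F n in p. n \<in> A}"
    have closed: "closedin X c" if c: "c \<in> ?\<C>" for c
    proof -
      obtain A where A: "c = h A" using c by blast
      have "c = topspace X - h (- A)"
        using h_subset[of A] by (auto simp: A h_Compl)
      then show ?thesis by (simp add: closedin_diff h_open)
    qed
    have fip: "\<Inter>\<F> \<noteq> {}" if \<F>: "finite \<F>" "\<F> \<subseteq> ?\<C>" for \<F>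
    proof -
      have "\<exists>A. (\<forall>\<^sub>F n in p. n \<in> A) \<and> h A \<subseteq> \<Inter>\<F>"
        using \<F>
      proof (induction \<F>)
        case empty
        show ?case by (intro exI[of _ UNIV]) simp
      next
        case (insert c \<F>)
        then obtain A B where "\<forall>\<^sub>F n in p. n \<in> A" "h A \<subseteq> \<Inter>\<F>" "\<forall>\<^sub>F n in p. n \<in> B" "c = h B"
          by blast
        then show ?case
          by (intro exI[of _ "A \<inter> B"]) (auto simp: h_Int eventually_conj_iff)
      qed
      then obtain A where A: "\<forall>\<^sub>F n in p. n \<in> A" "h A \<subseteq> \<Inter>\<F>" by blast
      have "h A \<noteq> {}"
      proof
        assume "h A = {}"
        then have "h {n. n \<notin> A} = topspace X"
          using h_Compl[of A] by (simp add: Compl_eq)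
        then have "\<forall>\<^sub>F n in p. n \<notin> A"
          using p(2) by (simp add: le_filter_def eventually_F_iff_h)
        then show False
          using A(1) ultrafilter_not[OF p(1)] by blast
      qed
      then show ?thesis using A(2) by blast
    qed
    have "\<Inter>?\<C> \<noteq> {}"
      by (rule assms[unfolded compact_space_fip, rule_format]) (intro conjI ballI allI impI closed fip; simp)
    then obtain x where "x \<in> \<Inter>?\<C>" by (metis ex_in_conv)
    then have x: "x \<in> h A" if "\<forall>\<^sub>F n in p. n \<in> A" for A
      using that by (simp add: INT_iff)
    have xX: "x \<in> topspace X"
      using x[of UNIV] by simp
    have "p = point_filter x"
      unfolding filter_eq_iff eventually_point_filter[OF xX]
    proof
      fix P
      have "x \<in> h (Collect P)" if "eventually P p"
        using x[of "Collect P"] that by simp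
      moreover have "x \<notin> h (Collect P)" if "\<not> eventually P p"
        using x[of "- Collect P"] that by (simp add: ultrafilter_not[OF p(1)] h_Compl)
      ultimately show "eventually P p \<longleftrightarrow> x \<in> h (Collect P)" by blast
    qed
    then show "p \<in> point_filter ` topspace X"
      using xX by blast
  qed
qed

text \<open>
  The clopen sets separate the points of \<open>X\<close>: the closure of an open set is clopen, and it misses the
  open sets disjoint from the given one.
\<close>

lemma inj_point_filter:
  assumes "Hausdorff_space X" "extremally_disconnected_space X"
  shows "inj_on point_filter (topspace X)"
proof (rule inj_onI, rule ccontr)
  fix x y assume xy: "x \<in> topspace X" "y \<in> topspace X" "point_filter x = point_filter y" "x \<noteq> y"
  then obtain U V where UV: "openin X U" "openin X V" "x \<in> U" "y \<in> V" "disjnt U V"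
    using assms(1) unfolding Hausdorff_space_def by metis
  have "openin X (X closure_of U)"
    using assms(2) UV(1) by (simp add: extremally_disconnected_space_def)
  then have "clopenin X (X closure_of U)"
    by (simp add: clopenin_def)
  then obtain M where M: "h M = X closure_of U"
    using h_surj by blast
  have "x \<in> h M"
    unfolding M by (rule subsetD[OF closure_of_subset[OF openin_subset[OF UV(1)]] UV(3)])
  moreover have "V \<inter> U = {}"
    using UV(5) by (auto simp: disjnt_def)
  then have "V \<inter> X closure_of U = {}"
    by (simp add: openin_Int_closure_of_eq_empty[OF UV(2)])
  then have "y \<notin> h M"
    unfolding M using UV(4) by blast
  ultimately show False
    using point_filter_in_stone[OF xy(1), of M] point_filter_in_stone[OF xy(2), of M] xy(3) by simp
qed

lemma K_homeomorphic:
  assumes "compact_space X" "Hausdorff_space X" "extremally_disconnected_space X"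
  shows "subtopology omega_star (K_set F) homeomorphic_space X"
proof -
  let ?Y = "subtopology omega_star (K_set F)"
  have topY: "topspace ?Y = K_set F"
    using K_set_subset[OF F_le_cofinite] by auto
  have "continuous_map X beta_omega point_filter"
    unfolding beta_omega_eq
  proof (rule continuous_on_generated_topo)
    fix U assume "U \<in> range stone"
    then obtain A where A: "U = stone A" by blast
    have "point_filter -` U \<inter> topspace X = h A"
      using h_subset[of A] by (auto simp: A point_filter_in_stone)
    then show "openin X (point_filter -` U \<inter> topspace X)"
      by (simp add: h_open)
  next
    show "point_filter ` topspace X \<subseteq> \<Union>(range stone)"
      using point_filter_in_stone[of _ UNIV] by auto
  qed
  moreover have "point_filter x \<in> topspace omega_star" if "x \<in> topspace X" for x
    using point_filter_in_K[OF that] K_set_subset[OF F_le_cofinite] by blast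
  ultimately have "continuous_map X ?Y point_filter"
    using point_filter_in_K by (auto simp: omega_star_def continuous_map_in_subtopology)
  moreover have "Hausdorff_space ?Y"
    unfolding omega_star_def by (intro Hausdorff_space_subtopology Hausdorff_beta_omega)
  moreover have "point_filter ` topspace X = topspace ?Y"
    unfolding topY by (simp add: K_eq_image assms(1))
  ultimately have "homeomorphic_map X ?Y point_filter"
    using assms by (intro continuous_imp_homeomorphic_map inj_point_filter)
  then show ?thesis
    using homeomorphic_map_imp_homeomorphic_space homeomorphic_space_sym by blast
qed

text \<open>
  By compactness finitely many basic sets \<open>stone A \<inter> topspace omega_star\<close> inside \<open>U\<close> cover \<open>K_set F\<close>.
  The union of these \<open>A\<close> belongs to \<open>F\<close>, so it almost contains some \<open>C \<alpha>\<close>.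
\<close>

lemma open_nbhd_of_K:
  assumes comp: "compact_space X" and U: "openin omega_star U" "K_set F \<subseteq> U"
  shows "\<exists>\<alpha>. \<forall>B. finite (B - C \<alpha>) \<longrightarrow> stone B \<inter> topspace omega_star \<subseteq> U"
proof -
  define \<A> where "\<A> = {A. stone A \<inter> topspace omega_star \<subseteq> U}"
  have "topspace X \<subseteq> \<Union>(h ` \<A>)"
  proof
    fix x assume x: "x \<in> topspace X"
    then have "point_filter x \<in> U"
      using point_filter_in_K U(2) by blast
    then obtain A where "point_filter x \<in> stone A" "A \<in> \<A>"
      using omega_star_base[OF U(1)] by (auto simp: \<A>_def)
    then show "x \<in> \<Union>(h ` \<A>)"
      using point_filter_in_stone[OF x] by blast
  qed
  moreover have "\<forall>c\<in>h ` \<A>. openin X c"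
    by (simp add: h_open)
  ultimately have "\<exists>\<F>. finite \<F> \<and> \<F> \<subseteq> h ` \<A> \<and> topspace X \<subseteq> \<Union>\<F>"
    using comp unfolding compact_space_alt by metis
  then obtain \<B> where \<B>: "finite \<B>" "\<B> \<subseteq> \<A>" "topspace X \<subseteq> \<Union>(h ` \<B>)"
    by (metis finite_subset_image)
  have "h (- \<Union>\<B>) = {}"
  proof (rule ccontr)
    assume "h (- \<Union>\<B>) \<noteq> {}"
    then obtain x B where x: "x \<in> h (- \<Union>\<B>)" "B \<in> \<B>" "x \<in> h B"
      using \<B>(3) h_subset by blast
    then have "x \<in> h (- \<Union>\<B> \<inter> B)"
      by (simp add: h_Int)
    moreover have "- \<Union>\<B> \<inter> B = {}"
      using x(2) by blast
    ultimately show False by simp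
  qed
  then obtain \<alpha> where \<alpha>: "finite (- \<Union>\<B> \<inter> C \<alpha>)"
    using h_null by blast
  show ?thesis
  proof (intro exI allI impI subsetI)
    fix B p assume B: "finite (B - C \<alpha>)" and p: "p \<in> stone B \<inter> topspace omega_star"
    then have up: "ultrafilter p" and le: "p \<le> cofinite" and "\<forall>\<^sub>F n in p. n \<in> B"
      by (auto simp: stone_def topspace_omega_star)
    have "finite ((- \<Union>\<B> \<inter> C \<alpha>) \<union> (B - C \<alpha>))"
      using \<alpha> B by simp
    then have "finite (B - \<Union>\<B>)"
      by (rule finite_subset[rotated]) blast
    then have "\<forall>\<^sub>F n in cofinite. n \<notin> B - \<Union>\<B>"
      unfolding eventually_cofinite not_not Collect_mem_eq .
    then have "\<forall>\<^sub>F n in p. n \<notin> B - \<Union>\<B>"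
      using le by (simp add: le_filter_def)
    with \<open>\<forall>\<^sub>F n in p. n \<in> B\<close> have "\<forall>\<^sub>F n in p. n \<in> \<Union>\<B>"
      by eventually_elim blast
    then obtain A where "A \<in> \<B>" "p \<in> stone A"
      using ultrafilter_finite_Union[OF up \<B>(1)] up by (auto simp: stone_def)
    then show "p \<in> U"
      using \<B>(2) p unfolding \<A>_def by blast
  qed
qed

text \<open>
  Each of the countably many open sets that define \<open>G\<close> contains the neighbourhood of \<open>K_set F\<close> given by
  some \<open>C \<alpha>\<close>.  A bound of these indices gives a neighbourhood that is contained in all of them.
\<close>

lemma P_set_K:
  assumes MA: "Martins_axiom" and comp: "compact_space X"
  shows "P_set omega_star (K_set F)"
  unfolding P_set_def
proof (intro conjI allI impI, rule closedin_K_set[OF F_le_cofinite], elim conjE)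
  fix G assume "gdelta_in omega_star G" and KG: "K_set F \<subseteq> G"
  then obtain \<U> where \<U>: "countable \<U>" "\<And>U. U \<in> \<U> \<Longrightarrow> openin omega_star U" "\<Inter>\<U> = G"
    unfolding gdelta_in_alt intersection_of_def by blast
  have "\<forall>U\<in>\<U>. \<exists>\<alpha>. \<forall>B. finite (B - C \<alpha>) \<longrightarrow> stone B \<inter> topspace omega_star \<subseteq> U"
    using open_nbhd_of_K[OF comp] \<U>(2,3) KG by blast
  then obtain a where a: "\<And>U B. U \<in> \<U> \<Longrightarrow> finite (B - C (a U)) \<Longrightarrow> stone B \<inter> topspace omega_star \<subseteq> U"
    by metis
  obtain \<alpha> where \<alpha>: "\<And>n. finite (C \<alpha> - C (a (from_nat_into \<U> n)))"
    using countable_bound[OF MA, of "\<lambda>n. a (from_nat_into \<U> n)"] by blast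
  have "stone (C \<alpha>) \<inter> topspace omega_star \<subseteq> U" if "U \<in> \<U>" for U
    using a[OF that, of "C \<alpha>"] \<alpha> from_nat_into_surj[OF \<U>(1) that] by metis
  then have "stone (C \<alpha>) \<inter> topspace omega_star \<subseteq> G"
    using \<U>(3) by blast
  then have "stone (C \<alpha>) \<inter> topspace omega_star \<subseteq> omega_star interior_of G"
    by (rule interior_of_maximal) (rule openin_omega_star_stone)
  moreover have "K_set F \<subseteq> stone (C \<alpha>)"
    using eventually_C by (auto simp: K_set_def stone_def le_filter_def)
  ultimately show "K_set F \<subseteq> omega_star interior_of G"
    using K_set_subset[OF F_le_cofinite] by blast
qed

end

section \<open>The theorem\<close>

theorem theorem5p2:
  fixes X :: "'a topology"
  assumes "Hausdorff_space X"
    and "separable_space X"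
    and "compact_space X"
    and "extremally_disconnected_space X"
    and "Martins_axiom"
  shows "\<exists>F :: nat filter.
    F \<le> cofinite \<and>
    reversible_filter F \<and>
    (\<exists>A. tower continuum A \<and> F = tower_filter continuum A) \<and>
    P_set omega_star (K_set F) \<and>
    subtopology omega_star (K_set F) homeomorphic_space X"
proof (cases "topspace X = {}")
  case True
  have K: "K_set bot = {}"
    by (auto simp: K_set_def ultrafilter_def bot_unique)
  have "reversible_filter bot"
    by (rule reversible_filterI) (auto intro: exI[of _ "{}"])
  moreover have "P_set omega_star {}"
    by (simp add: P_set_def)
  moreover have "subtopology omega_star {} homeomorphic_space X"
    using True by (simp add: homeomorphic_empty_space_eq)
  ultimately show ?thesis
    using bot_is_tower_filter by (intro exI[of _ bot]) (auto simp: K)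
next
  case False
  obtain C h where "quotient_tower X C h"
    using quotient_tower_exists[OF assms(5,2,4) False] .
  then interpret quotient_tower X C h .
  show ?thesis
    using F_le_cofinite reversible_F tower_C P_set_K[OF assms(5,3)]
      K_homeomorphic[OF assms(3,1,4)]
    by (intro exI[of _ F]) blast
qed

end
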